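(* The following statements are equivalent (in ZFC): (1) $\mathrm{non}(\mathcal M)=\aleph_1$. (2) There exists a sequence $\langle f_m\mid m<\omega\rangle$ of functions from $\omega_1$ to $\omega_1$ such that for every cofinal subset $B\subseteq\omega_1$ there exists $m<\omega$ with $f_m[B]=\omega_1$. (3) There exists a sequence $\langle g_n\mid n<\omega\rangle$ of functions from $\omega_1$ to $\omega_1$ such that for every uncountable pairwise disjoint family $\mathcal B$ of finite subsets of $\omega_1$ there are infinitely many $n<\omega$ such that for every $\gamma<\omega_1$ there is $b\in\mathcal B$ with $g_n[b]=\{\gamma\}$. (4) There exists a coloring $c:[\omega_1]^2\to\omega_1\times\omega$ with finite-to-one fibers such that for every $k<\omega$ and infinite pairwise disjoint family $\mathcal A\subseteq[\omega_1]^k$, and every $l<\omega$ and uncountable pairwise disjoint family $\mathcal B\subseteq[\omega_1]^l$, there exists $a\in\mathcal A$ such that for every $\delta<\omega_1$ there are $\iota<\omega$ and $b\in\mathcal B$ such that $\{\alpha<\beta\mid c(\alpha,\beta)=(\delta,\iota)\}=a$ for every $\beta\in b$. (5) For every $\ell_\infty$-coherent partition $p:[\omega_1]^2\to\omega$ there exists a coloring $d:[\omega_1]^2\to\omega_1$ such that for every $k<\omega$ and infinite pairwise disjoint family $\mathcal A\subseteq[\omega_1]^k$, and every $l<\omega$ and uncountable pairwise disjoint family $\mathcal B\subseteq[\omega_1]^l$, there exists $a\in\mathcal A$ such that for every matrix $\langle\tau_{n,m}\mid n<k,\ m<l\rangle$ of functions from $\omega$ to $\omega_1$ there exists $b\in\mathcal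 B$ such that $d(a(n),b(m))=\tau_{n,m}(p(a(n),b(m)))$ for all $n<k$ and $m<l$. (6) There exists a coloring $e:[\omega_1]^2\to\omega$ such that for every infinite $A\subseteq\omega_1$ and uncountable $B\subseteq\omega_1$ there is $\alpha\in A$ with $\{e(\alpha,\beta)\mid\beta\in B\setminus(\alpha+1)\}=\omega$. (7) There exists a set $X\subseteq{}^\omega\omega$ of size $\aleph_1$ such that for every $y:\omega\to\omega$ there is $x\in X$ with $x\cap y$ infinite (i.e., $x(n)=y(n)$ for infinitely many $n$).
   Context: $\mathrm{non}(\mathcal M)$ is the least cardinality of a nonmeager set of reals. $[\omega_1]^2$ denotes the set of pairs $(\alpha,\beta)$ with $\alpha<\beta<\omega_1$, and a coloring on $[\omega_1]^2$ is a function on these pairs, written $c(\alpha,\beta)$; $[\omega_1]^k$ is the set of $k$-element subsets of $\omega_1$. For a finite set $a$ of ordinals, $a(i)$ denotes the $i$-th element of $a$ in increasing order. A coloring $c$ on $[\omega_1]^2$ has finite-to-one fibers iff $\{\alpha<\beta\mid c(\alpha,\beta)=v\}$ is finite for every $\beta<\omega_1$ and every value $v$. A partition $p:[\omega_1]^2\to\omega$ is $\ell_\infty$-coherent iff $\{p(\alpha,\beta)-p(\alpha,\beta')\mid\alpha<\beta\}$ is finite for all $\beta<\beta'<\omega_1$. A subset of $\omega_1$ is cofinal iff it is unbounded in $\omega_1$. *)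

theory Defs
  imports "HOL-Analysis.Analysis" "HOL-Library.Countable_Set_Type"
    "HOL-Library.Disjoint_Sets"
begin

unbundle cardinal_syntax

abbreviation aleph1 :: "nat set rel" where
  "aleph1 \<equiv> cardSuc natLeq"

text \<open>
  The ordinal \<open>\<omega>\<^sub>1\<close> is the well-ordered type whose elements are the field of the
  cardinal \<open>\<aleph>\<^sub>1\<close> (cardinals are initial well-orders), ordered by that well-order.
\<close>

typedef omega1 = "Field aleph1"
proof -
  have "infinite (Field aleph1)"
    using cardSuc_finite[OF natLeq_Card_order] Field_natLeq by simp
  then show ?thesis
    by (metis ex_in_conv finite.emptyI)
qed

lemma aleph1_Well_order: "Well_order aleph1"
  using cardSuc_Card_order[OF natLeq_Card_order] by (simp add: card_order_on_def)

instantiation omega1 :: wellorder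
begin

definition less_eq_omega1 :: "omega1 \<Rightarrow> omega1 \<Rightarrow> bool" where
  "\<alpha> \<le> \<beta> \<longleftrightarrow> (Rep_omega1 \<alpha>, Rep_omega1 \<beta>) \<in> aleph1"

definition less_omega1 :: "omega1 \<Rightarrow> omega1 \<Rightarrow> bool" where
  "\<alpha> < \<beta> \<longleftrightarrow> \<alpha> \<le> \<beta> \<and> \<not> \<beta> \<le> (\<alpha> :: omega1)"

instance
proof
  fix x y z :: omega1
  have props: "refl_on (Field aleph1) aleph1" "trans aleph1" "antisym aleph1"
    "total_on (Field aleph1) aleph1" "wf (aleph1 - Id)"
    using aleph1_Well_order
    by (auto simp: well_order_on_def linear_order_on_def partial_order_on_def preorder_on_def)
  show "x < y \<longleftrightarrow> x \<le> y \<and> \<not> y \<le> x"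
    by (rule less_omega1_def)
  show "x \<le> x"
    using props(1) Rep_omega1[of x] by (auto simp: less_eq_omega1_def refl_on_def)
  show "x \<le> y \<Longrightarrow> y \<le> z \<Longrightarrow> x \<le> z"
    using props(2) by (auto simp: less_eq_omega1_def dest: transD)
  show "x \<le> y \<Longrightarrow> y \<le> x \<Longrightarrow> x = y"
    using props(3) by (auto simp: less_eq_omega1_def Rep_omega1_inject dest: antisymD)
  show "x \<le> y \<or> y \<le> x"
    using props(1,4) Rep_omega1[of x] Rep_omega1[of y]
    unfolding less_eq_omega1_def refl_on_def total_on_def by metis
  fix P :: "omega1 \<Rightarrow> bool" and a :: omega1
  assume step: "\<And>x. (\<And>y. y < x \<Longrightarrow> P y) \<Longrightarrow> P x"
  have "wf (inv_image (aleph1 - Id) Rep_omega1)"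
    using props(5) by (rule wf_inv_image)
  then show "P a"
  proof (induction a rule: wf_induct_rule)
    case (less x)
    show ?case
    proof (rule step)
      fix y assume "y < x"
      then have "(y, x) \<in> inv_image (aleph1 - Id) Rep_omega1"
        by (auto simp: less_omega1_def less_eq_omega1_def)
      then show "P y"
        by (rule less.IH)
    qed
  qed
qed

end

lemma card_of_omega1: "|UNIV :: omega1 set| =o aleph1"
proof -
  have "bij_betw Rep_omega1 UNIV (Field aleph1)"
    unfolding bij_betw_def
    using type_definition.Rep_range[OF type_definition_omega1] Rep_omega1_inject
    by (auto intro: injI)
  then have "|UNIV :: omega1 set| =o |Field aleph1|"
    using card_of_ordIso by blast
  then show ?thesis
    using card_of_Field_ordIso[OF cardSuc_Card_order[OF natLeq_Card_order]]
    by (rule ordIso_transitive)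
qed

lemma uncountable_UNIV_omega1: "uncountable (UNIV :: omega1 set)"
proof
  assume "countable (UNIV :: omega1 set)"
  then have "|UNIV :: omega1 set| \<le>o natLeq"
    using countable_card_le_natLeq by blast
  then have "aleph1 \<le>o natLeq"
    using card_of_omega1 ordIso_ordLeq_trans ordIso_symmetric by blast
  then show False
    using cardSuc_greater[OF natLeq_Card_order] not_ordLess_ordLeq by blast
qed

lemma countable_lessThan_omega1: "countable {..< \<alpha> :: omega1}"
proof -
  have "|underS aleph1 (Rep_omega1 \<alpha>)| <o aleph1"
    by (rule card_of_underS[OF cardSuc_Card_order[OF natLeq_Card_order] Rep_omega1])
  then have "|underS aleph1 (Rep_omega1 \<alpha>)| \<le>o natLeq"
    using cardSuc_ordLeq_ordLess[OF natLeq_Card_order card_of_Card_order] by blast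
  then have "countable (underS aleph1 (Rep_omega1 \<alpha>))"
    using countable_card_le_natLeq by blast
  moreover have "Rep_omega1 ` {..< \<alpha>} \<subseteq> underS aleph1 (Rep_omega1 \<alpha>)"
    by (auto simp: underS_def less_omega1_def less_eq_omega1_def)
  ultimately have "countable (Rep_omega1 ` {..< \<alpha>})"
    by (rule countable_subset[rotated])
  then show ?thesis
    by (rule countable_image_inj_on) (auto intro: inj_onI simp: Rep_omega1_inject)
qed

definition nowhere_dense :: "'a :: topological_space set \<Rightarrow> bool" where
  "nowhere_dense S \<longleftrightarrow> interior (closure S) = {}"

definition meager :: "'a :: topological_space set \<Rightarrow> bool" where
  "meager S \<longleftrightarrow> (\<exists>N :: nat \<Rightarrow> 'a set. (\<forall>n. nowhere_dense (N n)) \<and> S = (\<Union>n. N n))"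

text \<open>
  \<open>non(\<M>)\<close> as a cardinal order; the choice of the witnessing set does not matter up to
  \<open>=o\<close>, and the lemma \<open>non_M_least\<close> shows that a witness exists.
\<close>

definition non_M :: "real rel" where
  "non_M = |SOME X :: real set. \<not> meager X \<and> (\<forall>Y :: real set. \<not> meager Y \<longrightarrow> |X| \<le>o |Y| )|"

lemma not_meager_UNIV_real: "\<not> meager (UNIV :: real set)"
proof
  assume "meager (UNIV :: real set)"
  then obtain N :: "nat \<Rightarrow> real set"
    where N: "\<And>n. interior (closure (N n)) = {}" and U: "UNIV = (\<Union>n. N n)"
    unfolding meager_def nowhere_dense_def by blast
  have "(UNIV :: real set) \<subseteq> closure (\<Inter> (range (\<lambda>n. - closure (N n))))"
  proof (rule Baire)
    show "countable (range (\<lambda>n. - closure (N n)))" by simp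
    show "openin (top_of_set UNIV) T \<and> UNIV \<subseteq> closure T"
      if "T \<in> range (\<lambda>n. - closure (N n))" for T :: "real set"
      using that N by (auto simp: closure_complement)
  qed simp
  moreover have "\<Inter> (range (\<lambda>n. - closure (N n))) = {}"
  proof -
    have "\<exists>n. x \<in> closure (N n)" for x
      using U closure_subset by (metis UNIV_I UN_E subsetD)
    then show ?thesis by auto
  qed
  ultimately show False by simp
qed

lemma non_M_least:
  "\<exists>X :: real set. \<not> meager X \<and> non_M = |X|"
  "\<not> meager (Y :: real set) \<Longrightarrow> non_M \<le>o |Y|"
proof -
  let ?P = "\<lambda>X :: real set. \<not> meager X \<and> (\<forall>Y :: real set. \<not> meager Y \<longrightarrow> |X| \<le>o |Y| )"
  let ?R = "card_of ` {X :: real set. \<not> meager X}"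
  have "\<exists>r \<in> ?R. \<forall>r' \<in> ?R. r \<le>o r'"
    by (rule exists_minim_Card_order) (use not_meager_UNIV_real card_of_Card_order in auto)
  then have "\<exists>X. ?P X" by auto
  then have "?P (SOME X. ?P X)" by (rule someI_ex)
  then show "\<exists>X :: real set. \<not> meager X \<and> non_M = |X|"
    and "\<not> meager (Y :: real set) \<Longrightarrow> non_M \<le>o |Y|"
    unfolding non_M_def by blast+
qed

text \<open>
  A coloring of \<open>[\<omega>\<^sub>1]\<^sup>2\<close> is a total curried function \<open>c\<close> on \<open>omega1\<close>, of which only the values
  \<open>c \<alpha> \<beta>\<close> with \<open>\<alpha> < \<beta>\<close> are ever used.
\<close>

definition finite_to_one_fibers :: "(omega1 \<Rightarrow> omega1 \<Rightarrow> 'v) \<Rightarrow> bool" where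
  "finite_to_one_fibers c \<longleftrightarrow> (\<forall>\<beta> v. finite {\<alpha>. \<alpha> < \<beta> \<and> c \<alpha> \<beta> = v})"

definition linf_coherent :: "(omega1 \<Rightarrow> omega1 \<Rightarrow> nat) \<Rightarrow> bool" where
  "linf_coherent p \<longleftrightarrow>
     (\<forall>\<beta> \<beta>'. \<beta> < \<beta>' \<longrightarrow> finite {int (p \<alpha> \<beta>) - int (p \<alpha> \<beta>') | \<alpha>. \<alpha> < \<beta>})"

text \<open>\<open>nth_elem a i\<close> is \<open>a(i)\<close>, for finite \<open>a\<close> and \<open>i < card a\<close>.\<close>

definition nth_elem :: "'a :: linorder set \<Rightarrow> nat \<Rightarrow> 'a" where
  "nth_elem a i = sorted_list_of_set a ! i"

definition k_subsets :: "nat \<Rightarrow> 'a set set" where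
  "k_subsets k = {a. finite a \<and> card a = k}"

definition all_equivalent :: "bool list \<Rightarrow> bool" where
  "all_equivalent Ps \<longleftrightarrow> (\<forall>P \<in> set Ps. \<forall>Q \<in> set Ps. P \<longleftrightarrow> Q)"

end

theory Submission
  imports Defs
begin

text \<open>
  Everything is routed through a guessing principle: there are \<open>g\<^sub>n : \<omega>\<^sub>1 \<rightarrow> \<omega>\<^sub>1\<close> such that any
  prescribed sequence of values is met infinitely often, simultaneously at all points of any finite
  set \<open>b\<close> lying high enough in \<open>\<omega>\<^sub>1\<close>. It follows from (7): a point \<open>\<beta>\<close> enumerates all
  parameters below it (a member of \<open>X\<close> and an enumeration of a countable ordinal), and the index
  \<open>n\<close> carries, via a countable dense set of functions \<open>\<omega>\<^sub>1 \<rightarrow> \<omega>\<close>, the finite information telling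
  each \<open>\<beta> \<in> b\<close> which parameter to use. For (4) and (5) the values of \<open>g\<^sub>n\<close> are read as lists of
  disjoint blocks, so long that some block is untouched by the lists with smaller index, for all
  \<open>\<beta> \<in> b\<close> at once; each ordinal is coloured by the first list that mentions it.

  Conversely (6) yields \<open>\<aleph>\<^sub>1\<close> many reals that match any \<open>y\<close> infinitely often on any given infinite
  set. Two successive guesses (a growth rate \<open>g\<close>, then, at the places where \<open>g\<close> grows fast enough,
  the reactions to all intervals with index below \<open>g n\<close>) produce nested intervals whose limit
  escapes a given meager set.
\<close>

section \<open>Countable ordinals\<close>

text \<open>A countable cofinal set would cover \<open>omega1\<close> by countably many initial
  segments, each countable.\<close>

lemma countable_omega1_bounded:
  assumes "countable (S :: omega1 set)"
  shows "\<exists>\<xi>. \<forall>x\<in>S. x < \<xi>"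
proof (rule ccontr)
  assume "\<not> ?thesis"
  then have "\<exists>x\<in>S. \<xi> \<le> x" for \<xi>
    by (meson not_le)
  then have "UNIV \<subseteq> (\<Union>x\<in>S. insert x {..<x})"
    by (force simp: order_le_less)
  moreover have "countable (\<Union>x\<in>S. insert x {..<x})"
    using assms countable_lessThan_omega1 by (intro countable_UN) auto
  ultimately show False
    using uncountable_UNIV_omega1 countable_subset by blast
qed

lemma countable_atMost_omega1: "countable {..\<xi> :: omega1}"
proof -
  have "{..\<xi>} = insert \<xi> {..<\<xi>}"
    by auto
  then show ?thesis
    by (simp add: countable_lessThan_omega1)
qed

lemma uncountable_omega1_iff_cofinal: "uncountable B \<longleftrightarrow> \<not> bdd_above (B :: omega1 set)"
proof
  show "\<not> bdd_above B" if "uncountable B"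
    using that countable_subset[OF _ countable_atMost_omega1, of B]
    by (auto simp: bdd_above_def)
  show "uncountable B" if "\<not> bdd_above B"
    using that countable_omega1_bounded[of B] by (meson bdd_above.I less_imp_le)
qed

text \<open>Choosing a point \<le> \<xi> is injective on a disjoint family, and
  \<open>{..\<xi>}\<close> is countable, so only countably many members reach down to \<xi>.\<close>

lemma disjoint_family_above:
  fixes \<B> :: "omega1 set set"
  assumes "uncountable \<B>" "disjoint \<B>"
  shows "\<exists>b\<in>\<B>. b \<noteq> {} \<and> (\<forall>\<beta>\<in>b. \<xi> < \<beta>)"
proof (rule ccontr)
  assume neg: "\<not> ?thesis"
  define f where "f b = (SOME \<beta>. \<beta> \<in> b \<and> \<beta> \<le> \<xi>)" for b
  have f: "f b \<in> b \<and> f b \<le> \<xi>" if "b \<in> \<B> - {{}}" for b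
    unfolding f_def by (rule someI_ex) (use neg that in \<open>force simp: not_less\<close>)
  have "inj_on f (\<B> - {{}})"
  proof (rule inj_onI)
    fix b b' assume "b \<in> \<B> - {{}}" "b' \<in> \<B> - {{}}" "f b = f b'"
    then show "b = b'"
      using f[of b] f[of b'] assms(2) by (auto simp: disjoint_def)
  qed
  moreover have "countable (f ` (\<B> - {{}}))"
    by (rule countable_subset[OF _ countable_atMost_omega1[of \<xi>]]) (use f in auto)
  ultimately have "countable (\<B> - {{}})"
    by (rule countable_image_inj_on[rotated])
  then show False
    using assms(1) by (simp add: countable_Diff_eq)
qed

lemma uncountable_fiber:
  fixes f :: "'a \<Rightarrow> 'b :: countable"
  assumes "uncountable B"
  shows "\<exists>N. uncountable {x \<in> B. f x = N}"
proof (rule ccontr)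
  assume "\<not> ?thesis"
  then have "countable (\<Union>N. {x \<in> B. f x = N})"
    by (intro countable_UN) auto
  moreover have "(\<Union>N. {x \<in> B. f x = N}) = B"
    by auto
  ultimately show False
    using assms by simp
qed

section \<open>Enumerations, list codes and sets of size \<open>aleph1\<close>\<close>

lemma countable_subset_range:
  assumes "countable S"
  shows "\<exists>f :: nat \<Rightarrow> 'a. S \<subseteq> range f"
  using assms by (metis countableE_infinite empty_subsetI range_from_nat_into subset_refl)

lemma nat_into_omega1: "\<exists>f :: nat \<Rightarrow> omega1. inj f"
  using infinite_countable_subset[of "UNIV :: omega1 set"] uncountable_UNIV_omega1
    countable_finite by blast

text \<open>A pairing function is folded along the list. This separates only lists of equal length,
  so the length is coded as well.\<close>

lemma omega1_list_into_omega1: "\<exists>f :: omega1 list \<Rightarrow> omega1. inj f"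
proof -
  have "infinite (UNIV :: omega1 set)"
    using uncountable_UNIV_omega1 countable_finite by blast
  then have "|(UNIV :: omega1 set) \<times> (UNIV :: omega1 set)| \<le>o |UNIV :: omega1 set|"
    by (intro ordIso_imp_ordLeq card_of_Times_same_infinite)
  then obtain p :: "omega1 \<times> omega1 \<Rightarrow> omega1" where p: "inj p"
    by (auto simp: card_of_ordLeq[symmetric])
  obtain ord :: "nat \<Rightarrow> omega1" where ord: "inj ord"
    using nat_into_omega1 by blast
  define enc where "enc xs = foldr (\<lambda>x y. p (x, y)) xs undefined" for xs
  have enc: "length xs = length ys \<Longrightarrow> enc xs = enc ys \<Longrightarrow> xs = ys" for xs ys
    by (induction xs ys rule: list_induct2) (auto simp: enc_def dest: injD[OF p])
  have "inj (\<lambda>xs. p (ord (length xs), enc xs))"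
    by (rule injI) (auto dest!: injD[OF p] injD[OF ord] enc)
  then show ?thesis by blast
qed

lemma aleph1_le_card_of_uncountable: "uncountable (S :: 'a set) \<Longrightarrow> aleph1 \<le>o |S|"
  using cardSuc_ordLess_ordLeq[OF natLeq_Card_order card_of_Card_order]
  by (metis countable_card_le_natLeq card_of_Well_order natLeq_Well_order not_ordLess_iff_ordLeq)

lemma omega1_into_uncountable:
  assumes "uncountable (UNIV :: 'a set)"
  shows "\<exists>f :: omega1 \<Rightarrow> 'a. inj f"
proof -
  have "|UNIV :: omega1 set| \<le>o |UNIV :: 'a set|"
    using card_of_omega1 aleph1_le_card_of_uncountable[OF assms] ordIso_ordLeq_trans by blast
  then show ?thesis
    by (auto simp: card_of_ordLeq[symmetric])
qed

lemma card_range_omega1_le: "|f ` (UNIV :: omega1 set)| \<le>o aleph1"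
  using card_of_image card_of_omega1 ordLeq_ordIso_trans by blast

lemma range_omega1_if_card_le:
  assumes "|X| \<le>o aleph1" "X \<noteq> {}"
  shows "\<exists>x :: omega1 \<Rightarrow> 'a. X = range x"
proof -
  have "|X| \<le>o |UNIV :: omega1 set|"
    using assms(1) card_of_omega1 ordIso_symmetric ordLeq_ordIso_trans by blast
  then show ?thesis
    using assms(2) card_of_ordLeq2[of X "UNIV :: omega1 set"] by metis
qed

text \<open>The Hewitt--Marczewski--Pondiczery theorem: \<open>\<omega>\<^bsup>\<omega>\<^sub>1\<^esup>\<close> is separable.\<close>

lemma separable_functions_omega1:
  "\<exists>S :: nat \<Rightarrow> omega1 \<Rightarrow> nat. \<forall>b h. finite b \<longrightarrow> (\<exists>s. \<forall>\<beta>\<in>b. S s \<beta> = h \<beta>)"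
proof -
  have "uncountable (UNIV :: nat set set)"
    using Cantors_theorem[of "UNIV :: nat set"] unfolding uncountable_def Pow_UNIV by blast
  then obtain r :: "omega1 \<Rightarrow> nat set" where r: "inj r"
    using omega1_into_uncountable by blast
  \<comment> \<open>Distinct points receive distinct reals \<open>r \<beta>\<close>. A code
    \<open>s\<close> holds a precision \<open>q\<close> and a finite table giving values to the
    initial segments \<open>R q \<beta>\<close>; finitely many points are separated once
    \<open>q\<close> exceeds a position of difference for each pair.\<close>
  define R where "R q \<beta> = set_encode (r \<beta> \<inter> {..<q})" for q \<beta>
  define S where "S s \<beta> =
    (let (q, t) = (from_nat s :: nat \<times> (nat \<times> nat) list) in the (map_of t (R q \<beta>)))" for s \<beta>
  have "\<exists>s. \<forall>\<beta>\<in>b. S s \<beta> = h \<beta>" if b: "finite b" for b and h :: "omega1 \<Rightarrow> nat"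
  proof -
    define i where "i \<beta> \<beta>' = (SOME i. (i \<in> r \<beta>) \<noteq> (i \<in> r \<beta>'))" for \<beta> \<beta>'
    have i: "(i \<beta> \<beta>' \<in> r \<beta>) \<noteq> (i \<beta> \<beta>' \<in> r \<beta>')" if "\<beta> \<noteq> \<beta>'" for \<beta> \<beta>'
      unfolding i_def by (rule someI_ex) (use that r in \<open>unfold inj_def, blast\<close>)
    define q where "q = Suc (Max (insert 0 ((\<lambda>(\<beta>, \<beta>'). i \<beta> \<beta>') ` (b \<times> b))))"
    have q: "i \<beta> \<beta>' < q" if "\<beta> \<in> b" "\<beta>' \<in> b" for \<beta> \<beta>'
      unfolding q_def less_Suc_eq_le using that b by (intro Max_ge) auto
    have inj: "inj_on (R q) b"
    proof (rule inj_onI, rule ccontr)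
      fix \<beta> \<beta>' assume *: "\<beta> \<in> b" "\<beta>' \<in> b" "R q \<beta> = R q \<beta>'" "\<beta> \<noteq> \<beta>'"
      then have "r \<beta> \<inter> {..<q} = r \<beta>' \<inter> {..<q}"
        unfolding R_def by (subst (asm) set_encode_eq) auto
      then show False
        using i[OF *(4)] q[OF *(1,2)] by blast
    qed
    obtain bs where bs: "set bs = b" "distinct bs"
      using b finite_distinct_list by blast
    define t where "t = map (\<lambda>\<beta>. (R q \<beta>, h \<beta>)) bs"
    have "distinct (map fst t)"
      using bs inj by (simp add: t_def comp_def distinct_map)
    then have "map_of t (R q \<beta>) = Some (h \<beta>)" if "\<beta> \<in> b" for \<beta>
      using that bs by (intro map_of_is_SomeI) (auto simp: t_def)
    then have "S (to_nat (q, t)) \<beta> = h \<beta>" if "\<beta> \<in> b" for \<beta>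
      using that by (simp add: S_def)
    then show ?thesis by blast
  qed
  then show ?thesis by blast
qed

section \<open>Guessing\<close>

text \<open>The number \<open>h \<beta>\<close> selects one of countably many targets separately at
  each \<beta>. It is chosen together with \<open>b\<close>, after \<beta>0, so it may depend on the
  position of \<beta> in \<open>b\<close>.\<close>

definition guessing :: "(nat \<Rightarrow> omega1 \<Rightarrow> omega1) \<Rightarrow> bool" where
  "guessing g \<longleftrightarrow> (\<forall>\<Gamma> :: nat \<Rightarrow> nat \<Rightarrow> omega1. \<exists>\<beta>0. \<forall>b h. finite b \<and> (\<forall>\<beta>\<in>b. \<beta>0 < \<beta>) \<longrightarrow>
     infinite {n. \<forall>\<beta>\<in>b. g n \<beta> = \<Gamma> n (h \<beta>)})"

lemma guessing_if_infinitely_often_equal: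
  fixes X :: "(nat \<Rightarrow> nat) set"
  assumes "|X| =o aleph1" and ioe: "\<forall>y. \<exists>x\<in>X. infinite {n. x n = y n}"
  shows "\<exists>g. guessing g"
proof -
  have "X \<noteq> {}"
    using ioe by blast
  then obtain x :: "omega1 \<Rightarrow> nat \<Rightarrow> nat" where x: "X = range x"
    using range_omega1_if_card_le ordIso_imp_ordLeq[OF assms(1)] by blast
  obtain S :: "nat \<Rightarrow> omega1 \<Rightarrow> nat"
    where S: "\<And>b h. finite b \<Longrightarrow> \<exists>s. \<forall>\<beta>\<in>b. S s \<beta> = h \<beta>"
    using separable_functions_omega1 by blast
  have "\<exists>e :: nat \<Rightarrow> omega1 list. lists {..<\<gamma>} \<subseteq> range e" for \<gamma>
    using countable_lessThan_omega1 by (intro countable_subset_range) auto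
  then obtain E :: "omega1 \<Rightarrow> nat \<Rightarrow> omega1 list" where E: "\<And>\<gamma>. lists {..<\<gamma>} \<subseteq> range (E \<gamma>)"
    by metis
  have "\<exists>p :: nat \<Rightarrow> omega1 \<times> omega1. {..<\<beta>} \<times> {..<\<beta>} \<subseteq> range p" for \<beta>
    using countable_lessThan_omega1 by (intro countable_subset_range) auto
  then obtain P :: "omega1 \<Rightarrow> nat \<Rightarrow> omega1 \<times> omega1"
    where P: "\<And>\<beta>. {..<\<beta>} \<times> {..<\<beta>} \<subseteq> range (P \<beta>)"
    by metis
  \<comment> \<open>\<open>n\<close> codes a pair \<open>(s, m)\<close>. The separable family turns
    \<open>s\<close> into a pair \<open>(j, t)\<close> at \<beta>: \<open>j\<close> locates the
    parameters \<open>(\<gamma>, \<delta>)\<close> below \<beta>, and \<open>t\<close> is the target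
    index. The real \<open>x \<delta>\<close> guesses at \<open>m\<close> the code of a list over
    \<gamma>.\<close>
  define g where "g n \<beta> =
    (let (s, m) = prod_decode n; (j, t) = prod_decode (S s \<beta>); (\<gamma>, \<delta>) = P \<beta> j
     in E \<gamma> (x \<delta> m) ! prod_encode (s, t))" for n \<beta>
  have "\<exists>\<beta>0. \<forall>b h. finite b \<and> (\<forall>\<beta>\<in>b. \<beta>0 < \<beta>) \<longrightarrow> infinite {n. \<forall>\<beta>\<in>b. g n \<beta> = \<Gamma> n (h \<beta>)}"
    for \<Gamma> :: "nat \<Rightarrow> nat \<Rightarrow> omega1"
  proof -
    have "countable (\<Union>n. range (\<Gamma> n))"
      by auto
    from countable_omega1_bounded[OF this]
    obtain \<gamma> where "\<forall>z\<in>(\<Union>n. range (\<Gamma> n)). z < \<gamma>" ..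
    then have \<gamma>: "\<Gamma> n t < \<gamma>" for n t
      by auto
    \<comment> \<open>The \<open>s\<close> needed for given \<open>b\<close> and \<open>h\<close> is
      not known in advance, so \<open>L m\<close> lists the targets for all pairs
      \<open>(s, t)\<close> with code below \<open>m\<close>.\<close>
    define L where "L m = map (\<lambda>q. \<Gamma> (prod_encode (fst (prod_decode q), m)) (snd (prod_decode q))) [0..<m]" for m
    have "L m \<in> lists {..<\<gamma>}" for m
      using \<gamma> by (auto simp: L_def)
    then have "L m \<in> range (E \<gamma>)" for m
      using E by blast
    then have "\<forall>m. \<exists>y. E \<gamma> y = L m"
      by (auto simp: image_iff eq_commute)
    from choice[OF this] obtain y where y: "\<And>m. E \<gamma> (y m) = L m"
      by blast
    obtain \<delta> where \<delta>: "infinite {m. x \<delta> m = y m}"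
      using ioe x by blast
    have "infinite {n. \<forall>\<beta>\<in>b. g n \<beta> = \<Gamma> n (h \<beta>)}"
      if b: "finite b" "\<forall>\<beta>\<in>b. max \<gamma> \<delta> < \<beta>" for b and h :: "omega1 \<Rightarrow> nat"
    proof -
      have "(\<gamma>, \<delta>) \<in> range (P \<beta>)" if "\<beta> \<in> b" for \<beta>
        using b(2) that by (intro subsetD[OF P]) auto
      then have "\<forall>\<beta>\<in>b. \<exists>j. P \<beta> j = (\<gamma>, \<delta>)"
        by (auto simp: image_iff eq_commute)
      then obtain j where j: "\<And>\<beta>. \<beta> \<in> b \<Longrightarrow> P \<beta> (j \<beta>) = (\<gamma>, \<delta>)"
        by metis
      obtain s where s: "\<And>\<beta>. \<beta> \<in> b \<Longrightarrow> S s \<beta> = prod_encode (j \<beta>, h \<beta>)"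
        using S[OF b(1), of "\<lambda>\<beta>. prod_encode (j \<beta>, h \<beta>)"] by blast
      \<comment> \<open>Beyond \<open>k\<close> the list \<open>L m\<close> is long enough to hold
        the entries for all \<beta> in \<open>b\<close>.\<close>
      define k where "k = Max (insert 0 ((\<lambda>\<beta>. prod_encode (s, h \<beta>)) ` b))"
      have k: "prod_encode (s, h \<beta>) \<le> k" if "\<beta> \<in> b" for \<beta>
        unfolding k_def using that b(1) by (intro Max_ge) auto
      have "g (prod_encode (s, m)) \<beta> = \<Gamma> (prod_encode (s, m)) (h \<beta>)"
        if "x \<delta> m = y m" "k < m" "\<beta> \<in> b" for m \<beta>
        using that k[OF that(3)] by (simp add: g_def s j y L_def)
      then have "(\<lambda>m. prod_encode (s, m)) ` ({m. x \<delta> m = y m} - {..k})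
          \<subseteq> {n. \<forall>\<beta>\<in>b. g n \<beta> = \<Gamma> n (h \<beta>)}"
        by (auto simp: not_le)
      moreover have "infinite ((\<lambda>m. prod_encode (s, m)) ` ({m. x \<delta> m = y m} - {..k}))"
        using \<delta> by (subst finite_image_iff) (auto intro: inj_onI)
      ultimately show ?thesis
        using finite_subset by blast
    qed
    then show ?thesis by blast
  qed
  then show ?thesis
    unfolding guessing_def by blast
qed

lemma constant_images_if_guessing:
  assumes "guessing g" "uncountable \<B>" "disjoint \<B>" and fin: "\<forall>b\<in>\<B>. finite b"
  shows "infinite {n. \<forall>\<gamma>. \<exists>b\<in>\<B>. g n ` b = {\<gamma>}}"
proof
  let ?G = "{n. \<forall>\<gamma>. \<exists>b\<in>\<B>. g n ` b = {\<gamma>}}"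
  assume "finite ?G"
  \<comment> \<open>For \<open>n\<close> outside \<open>?G\<close> this is a value that is the
    constant image of no member of \<B>; guessing these values at a high enough member contradicts
    the choice.\<close>
  define \<Gamma> where "\<Gamma> n = (SOME \<gamma>. \<not> (\<exists>b\<in>\<B>. g n ` b = {\<gamma>}))" for n
  have \<Gamma>: "\<not> (\<exists>b\<in>\<B>. g n ` b = {\<Gamma> n})" if "n \<notin> ?G" for n
    unfolding \<Gamma>_def by (rule someI_ex) (use that in blast)
  obtain \<beta>0 where \<beta>0: "\<And>b h. finite b \<Longrightarrow> \<forall>\<beta>\<in>b. \<beta>0 < \<beta> \<Longrightarrow> infinite {n. \<forall>\<beta>\<in>b. g n \<beta> = \<Gamma> n}"
    using assms(1) unfolding guessing_def by (elim allE[of _ "\<lambda>n _. \<Gamma> n"]) blast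
  obtain b where b: "b \<in> \<B>" "b \<noteq> {}" "\<forall>\<beta>\<in>b. \<beta>0 < \<beta>"
    using disjoint_family_above[OF assms(2,3)] by blast
  have "infinite ({n. \<forall>\<beta>\<in>b. g n \<beta> = \<Gamma> n} - ?G)"
    using \<beta>0 b fin \<open>finite ?G\<close> by (intro Diff_infinite_finite) auto
  from infinite_imp_nonempty[OF this, folded ex_in_conv]
  obtain n where "n \<in> {n. \<forall>\<beta>\<in>b. g n \<beta> = \<Gamma> n} - ?G" ..
  then have n: "n \<notin> ?G" "\<forall>\<beta>\<in>b. g n \<beta> = \<Gamma> n"
    by auto
  then have "g n ` b = {\<Gamma> n}"
    using b(2) by auto
  then show False
    using \<Gamma>[OF n(1)] b(1) by blast
qed

lemma cofinal_image_if_constant_images: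
  assumes g: "\<And>\<B>. uncountable \<B> \<and> disjoint \<B> \<and> (\<forall>b\<in>\<B>. finite b) \<Longrightarrow>
    infinite {n. \<forall>\<gamma>. \<exists>b\<in>\<B>. (g :: nat \<Rightarrow> omega1 \<Rightarrow> omega1) n ` b = {\<gamma>}}"
    and B: "\<not> bdd_above B"
  shows "\<exists>m. g m ` B = UNIV"
proof -
  let ?\<B> = "(\<lambda>\<beta>. {\<beta>}) ` B"
  have "uncountable ?\<B>"
    using B by (simp add: uncountable_omega1_iff_cofinal[symmetric] countable_image_inj_eq)
  then have "infinite {n. \<forall>\<gamma>. \<exists>b\<in>?\<B>. g n ` b = {\<gamma>}}"
    by (intro g) (auto simp: disjoint_def)
  then obtain n where "\<forall>\<gamma>. \<exists>b\<in>?\<B>. g n ` b = {\<gamma>}"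
    using not_finite_existsD by blast
  then have "\<gamma> \<in> g n ` B" for \<gamma>
    by (elim allE[of _ \<gamma>]) auto
  then show ?thesis
    by blast
qed

section \<open>Families of reals that meet every real infinitely often\<close>

lemma infinitely_often_equal_card_aleph1:
  assumes X: "|X :: (nat \<Rightarrow> nat) set| \<le>o aleph1" "\<forall>y. \<exists>x\<in>X. infinite {n. x n = y n}"
  shows "\<exists>X :: (nat \<Rightarrow> nat) set. |X| =o aleph1 \<and> (\<forall>y. \<exists>x\<in>X. infinite {n. x n = y n})"
proof -
  have "uncountable X"
  proof
    assume "countable X"
    moreover have "X \<noteq> {}"
      using X(2) by blast
    ultimately obtain x :: "nat \<Rightarrow> nat \<Rightarrow> nat" where x: "X = range x"
      using uncountable_def by blast
    \<comment> \<open>At \<open>n\<close>, \<open>y\<close> exceeds the first \<open>n + 1\<close>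
      members of \<open>X\<close>, so each member agrees with it only finitely often.\<close>
    define y where "y n = Suc (\<Sum>i\<le>n. x i n)" for n
    obtain i where i: "infinite {n. x i n = y n}"
      using X(2) x by blast
    have "x i n < y n" if "i \<le> n" for n
      unfolding y_def less_Suc_eq_le using that by (intro member_le_sum) auto
    then have "{n. x i n = y n} \<subseteq> {..<i}"
      by (force simp: not_less[symmetric])
    then show False
      using i finite_subset by blast
  qed
  then have "|X| =o aleph1"
    using aleph1_le_card_of_uncountable X(1) ordIso_iff_ordLeq by blast
  then show ?thesis
    using X(2) by blast
qed

text \<open>If \<open>y\<close> escapes all \<open>x \<beta>\<close>, uncountably many \<beta> share
  a bound \<open>K\<close> on the places of agreement. Thinned out so that no \<open>f m\<close>
  with \<open>m < K\<close> is onto, this set still has some onto \<open>f m\<close>; then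
  \<open>m \<ge> K\<close>, but attaining \<open>ord (y m)\<close> is an agreement at
  \<open>m\<close>.\<close>

lemma infinitely_often_equal_if_cofinal_image:
  fixes f :: "nat \<Rightarrow> omega1 \<Rightarrow> omega1"
  assumes f: "\<And>B. \<not> bdd_above B \<Longrightarrow> \<exists>m. f m ` B = UNIV"
  shows "\<exists>X :: (nat \<Rightarrow> nat) set. |X| =o aleph1 \<and> (\<forall>y. \<exists>x\<in>X. infinite {n. x n = y n})"
proof -
  obtain ord :: "nat \<Rightarrow> omega1" where ord: "inj ord"
    using nat_into_omega1 by blast
  define x where "x \<beta> n = inv ord (f n \<beta>)" for \<beta> n
  have "\<exists>\<beta>. infinite {n. x \<beta> n = y n}" for y
  proof (rule ccontr)
    assume "\<not> ?thesis"
    then have "\<forall>\<beta>. \<exists>N. \<forall>n\<in>{n. x \<beta> n = y n}. n < N"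
      by (simp add: finite_nat_set_iff_bounded)
    from choice[OF this] obtain N where N: "\<And>\<beta> n. x \<beta> n = y n \<Longrightarrow> n < N \<beta>"
      by blast
    obtain K where K: "uncountable {\<beta>. N \<beta> = K}"
      using uncountable_fiber[OF uncountable_UNIV_omega1, of N] by auto
    have "\<exists>B \<subseteq> {\<beta>. N \<beta> = K}. uncountable B \<and> (\<forall>m<k. f m ` B \<noteq> UNIV)" for k
    proof (induction k)
      case 0
      then show ?case using K by blast
    next
      case (Suc k)
      then obtain B where B: "B \<subseteq> {\<beta>. N \<beta> = K}" "uncountable B" "\<forall>m<k. f m ` B \<noteq> UNIV"
        by blast
      \<comment> \<open>Either half misses a value of \<open>f k\<close>, and one of them is
        uncountable.\<close>
      define B0 where "B0 = {\<beta> \<in> B. f k \<beta> = ord 0}"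
      define B1 where "B1 = {\<beta> \<in> B. f k \<beta> \<noteq> ord 0}"
      have "B = B0 \<union> B1"
        by (auto simp: B0_def B1_def)
      then have "uncountable B0 \<or> uncountable B1"
        using B(2) countable_Un by blast
      moreover have "ord 1 \<notin> f k ` B0" "ord 0 \<notin> f k ` B1"
        using injD[OF ord, of 0 1] by (auto simp: B0_def B1_def)
      moreover have "B0 \<subseteq> B" "B1 \<subseteq> B"
        by (auto simp: B0_def B1_def)
      ultimately obtain B' where B': "B' \<subseteq> B" "uncountable B'" "f k ` B' \<noteq> UNIV"
        by (metis UNIV_I)
      have "f m ` B' \<noteq> UNIV" if "m < k" for m
        using B(3) that image_mono[OF B'(1), of "f m"] by blast
      then show ?case
        using B' B(1) by (intro exI[of _ B']) (auto simp: less_Suc_eq)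
    qed
    from this[of K]
    obtain B where B: "B \<subseteq> {\<beta>. N \<beta> = K}" "uncountable B" "\<forall>m<K. f m ` B \<noteq> UNIV"
      by blast
    obtain m where m: "f m ` B = UNIV"
      using f[of B] B(2) by (auto simp: uncountable_omega1_iff_cofinal)
    then obtain \<beta> where "\<beta> \<in> B" "f m \<beta> = ord (y m)"
      by (metis UNIV_I imageE)
    then have "m < K"
      using N[of \<beta> m] B(1) inv_f_f[OF ord] by (auto simp: x_def)
    then show False
      using B(3) m by blast
  qed
  then show ?thesis
    by (intro infinitely_often_equal_card_aleph1[OF card_range_omega1_le[of x]]) blast
qed

text \<open>
  The \<open>n\<close>-th list has \<open>n * guess_total n + 1\<close> blocks of size at most \<open>n\<close>, and \<open>guess_total n\<close>
  bounds the number of ordinals mentioned by its predecessors. So if \<open>b\<close> has at most \<open>n\<close> points,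
  one block of the list is mentioned by no predecessor at any of them.
\<close>

primrec guess_total :: "nat \<Rightarrow> nat" where
  "guess_total 0 = 0"
| "guess_total (Suc n) = guess_total n + n * Suc (n * guess_total n)"

lemma sum_le_guess_total:
  assumes "\<And>i. f i \<le> i * Suc (i * guess_total i)"
  shows "(\<Sum>i<n. f i) \<le> guess_total n"
proof (induction n)
  case (Suc n)
  then show ?case
    unfolding sum.lessThan_Suc guess_total.simps by (rule add_mono[OF _ assms])
qed simp

text \<open>At \<beta>, block \<iota> is the set \<open>A \<beta> \<iota>\<close> with label
  \<open>w \<beta> \<iota>\<close>, and \<open>H \<beta> \<alpha>\<close> is the index of the first
  block that mentions \<alpha>. Later mentions are ignored, so a guessed block must consist of
  points new at every \<beta> in \<open>b\<close>; counting with \<open>guess_total\<close> finds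
  one.\<close>

lemma block_guessing:
  assumes "guessing g"
  obtains H :: "omega1 \<Rightarrow> omega1 \<Rightarrow> nat option"
    and A :: "omega1 \<Rightarrow> nat \<Rightarrow> omega1 set" and w :: "omega1 \<Rightarrow> nat \<Rightarrow> omega1"
  where "\<And>\<beta> \<alpha> \<iota>. H \<beta> \<alpha> = Some \<iota> \<Longrightarrow> \<alpha> \<in> A \<beta> \<iota>"
    and "\<And>\<beta> \<iota>. finite (A \<beta> \<iota>)"
    and "\<And>(a :: nat \<Rightarrow> omega1 set) k (W :: nat \<Rightarrow> nat \<Rightarrow> omega1).
      range a \<subseteq> k_subsets k \<Longrightarrow> disjoint_family a \<Longrightarrow>
      \<exists>\<beta>0. \<forall>b h. finite b \<and> (\<forall>\<beta>\<in>b. \<beta>0 < \<beta>) \<longrightarrow>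
        (\<exists>i \<iota>. \<forall>\<beta>\<in>b. A \<beta> \<iota> = a i \<and> w \<beta> \<iota> = W i (h \<beta>) \<and> (\<forall>\<alpha>\<in>a i. H \<beta> \<alpha> = Some \<iota>))"
proof -
  obtain L :: "omega1 list \<Rightarrow> omega1" where L: "inj L"
    using omega1_list_into_omega1 by blast
  define code where "code ps = L (map (\<lambda>(a, v). L (v # a)) ps)" for ps
  have "inj (\<lambda>(a, v). L (v # a))"
    by (rule injI) (auto dest: injD[OF L])
  then have code: "inj code"
    unfolding code_def by (intro injI) (metis injD[OF L] inj_mapI injD)
  define cov where "cov ps = (\<Union>(a, v)\<in>set ps. set a)" for ps :: "(omega1 list \<times> omega1) list"
  \<comment> \<open>Oversized lists are replaced by the empty one: the bound on mentions must hold
    at every index, also where \<open>g n \<beta>\<close> is no correct guess.\<close>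
  define D where "D n \<beta> = (let ps = inv code (g n \<beta>) in
    if card (cov ps) \<le> n * Suc (n * guess_total n) then ps else [])" for n \<beta>
  have card_D: "card (cov (D n \<beta>)) \<le> n * Suc (n * guess_total n)" for n \<beta>
  proof (cases "card (cov (inv code (g n \<beta>))) \<le> n * Suc (n * guess_total n)")
    case False
    then have "D n \<beta> = []"
      unfolding D_def Let_def by (rule if_not_P)
    then show ?thesis
      by (simp add: cov_def)
  qed (simp add: D_def Let_def)
  have fin_D: "finite (cov (D n \<beta>))" for n \<beta>
    by (auto simp: cov_def)
  define A where "A \<beta> \<iota> = (let (n, t) = prod_decode \<iota> in set (fst (D n \<beta> ! t)))" for \<beta> \<iota>
  define w where "w \<beta> \<iota> = (let (n, t) = prod_decode \<iota> in snd (D n \<beta> ! t))" for \<beta> \<iota>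
  define H where "H \<beta> \<alpha> =
    (if \<exists>n. \<alpha> \<in> cov (D n \<beta>)
     then let n = LEAST n. \<alpha> \<in> cov (D n \<beta>)
       in Some (prod_encode (n, LEAST t. t < length (D n \<beta>) \<and> \<alpha> \<in> set (fst (D n \<beta> ! t))))
     else None)" for \<beta> \<alpha>
  have cov_nth: "\<alpha> \<in> cov ps \<longleftrightarrow> (\<exists>t. t < length ps \<and> \<alpha> \<in> set (fst (ps ! t)))" for \<alpha> ps
    by (force simp: cov_def in_set_conv_nth split_beta)
  show thesis
  proof (rule that)
    fix \<beta> \<alpha> \<iota>
    show "finite (A \<beta> \<iota>)"
      by (simp add: A_def split_beta)
    assume H: "H \<beta> \<alpha> = Some \<iota>"
    define n where "n = (LEAST n. \<alpha> \<in> cov (D n \<beta>))"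
    define t where "t = (LEAST t. t < length (D n \<beta>) \<and> \<alpha> \<in> set (fst (D n \<beta> ! t)))"
    have ex: "\<exists>n. \<alpha> \<in> cov (D n \<beta>)" and \<iota>: "\<iota> = prod_encode (n, t)"
      using H by (auto simp: H_def n_def t_def Let_def split: if_splits)
    have "\<alpha> \<in> cov (D n \<beta>)"
      unfolding n_def by (rule LeastI_ex[OF ex])
    then have "t < length (D n \<beta>) \<and> \<alpha> \<in> set (fst (D n \<beta> ! t))"
      unfolding t_def cov_nth by (rule LeastI_ex)
    then show "\<alpha> \<in> A \<beta> \<iota>"
      by (simp add: A_def \<iota>)
  next
    fix a :: "nat \<Rightarrow> omega1 set" and k and W :: "nat \<Rightarrow> nat \<Rightarrow> omega1"
    assume "range a \<subseteq> k_subsets k" and disj: "disjoint_family a"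
    then have a: "finite (a i)" "card (a i) = k" for i
      by (auto simp: k_subsets_def image_subset_iff)
    \<comment> \<open>Only the labels depend on \<open>t\<close>, so all \<beta> in \<open>b\<close>
      see the same blocks whatever \<open>h\<close> is.\<close>
    define ps where "ps n t = map (\<lambda>i. (sorted_list_of_set (a i), W i t)) [0..<Suc (n * guess_total n)]" for n t
    have cov_ps: "cov (ps n t) = (\<Union>i<Suc (n * guess_total n). a i)" for n t
      using a by (auto simp: cov_def ps_def simp del: upt_Suc)
    obtain \<beta>0 where \<beta>0: "\<And>b h. finite b \<Longrightarrow> \<forall>\<beta>\<in>b. \<beta>0 < \<beta> \<Longrightarrow>
        infinite {n. \<forall>\<beta>\<in>b. g n \<beta> = code (ps n (h \<beta>))}"
      using assms unfolding guessing_def by (elim allE[of _ "\<lambda>n t. code (ps n t)"]) blast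
    have "\<exists>i \<iota>. \<forall>\<beta>\<in>b. A \<beta> \<iota> = a i \<and> w \<beta> \<iota> = W i (h \<beta>) \<and> (\<forall>\<alpha>\<in>a i. H \<beta> \<alpha> = Some \<iota>)"
      if b: "finite b" "\<forall>\<beta>\<in>b. \<beta>0 < \<beta>" for b h
    proof -
      \<comment> \<open>\<open>n \<ge> k\<close> lets the guessed list pass the size test in
        \<open>D\<close>; \<open>n \<ge> card b\<close> makes \<open>card b * guess_total n\<close>
        smaller than the number of blocks.\<close>
      obtain n where "max k (card b) \<le> n" and g: "\<forall>\<beta>\<in>b. g n \<beta> = code (ps n (h \<beta>))"
        using \<beta>0[OF b, of h] unfolding infinite_nat_iff_unbounded_le by blast
      then have n: "k \<le> n" "card b \<le> n"
        by auto
      define r where "r = Suc (n * guess_total n)"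
      have "card (\<Union>i<r. a i) \<le> (\<Sum>i<r. card (a i))"
        by (rule card_UN_le) simp
      also have "\<dots> \<le> n * r"
        using n(1) by (simp add: a mult.commute)
      finally have D: "D n \<beta> = ps n (h \<beta>)" if "\<beta> \<in> b" for \<beta>
        using g that by (simp add: D_def Let_def inv_f_f[OF code] cov_ps r_def)
      define C where "C = (\<Union>\<beta>\<in>b. \<Union>m<n. cov (D m \<beta>))"
      have "card C \<le> (\<Sum>\<beta>\<in>b. card (\<Union>m<n. cov (D m \<beta>)))"
        unfolding C_def by (rule card_UN_le[OF b(1)])
      also have "\<dots> \<le> (\<Sum>\<beta>\<in>b. guess_total n)"
      proof (rule sum_mono)
        fix \<beta> assume "\<beta> \<in> b"
        have "card (\<Union>m<n. cov (D m \<beta>)) \<le> (\<Sum>m<n. card (cov (D m \<beta>)))"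
          by (rule card_UN_le) simp
        also have "\<dots> \<le> guess_total n"
          by (rule sum_le_guess_total[OF card_D])
        finally show "card (\<Union>m<n. cov (D m \<beta>)) \<le> guess_total n" .
      qed
      also have "\<dots> < r"
        using n(2) by (simp add: r_def less_Suc_eq_le)
      finally have card_C: "card C < r" .
      \<comment> \<open>The \<open>r\<close> disjoint blocks cannot all meet a set with fewer than
        \<open>r\<close> points.\<close>
      have "\<exists>i<r. a i \<inter> C = {}"
      proof (rule ccontr)
        assume "\<not> ?thesis"
        then have "\<forall>i\<in>{..<r}. \<exists>\<alpha>. \<alpha> \<in> a i \<inter> C"
          by blast
        from bchoice[OF this] obtain f where f: "\<And>i. i < r \<Longrightarrow> f i \<in> a i \<inter> C"
          by blast
        have "inj_on f {..<r}"
        proof (rule inj_onI)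
          fix i j assume ij: "i \<in> {..<r}" "j \<in> {..<r}" "f i = f j"
          then have "f i \<in> a i \<inter> a j"
            using f[of i] f[of j] by auto
          then show "i = j"
            using disj unfolding disjoint_family_on_def by blast
        qed
        moreover have "f ` {..<r} \<subseteq> C" "finite C"
          using f b(1) fin_D by (auto simp: C_def)
        ultimately show False
          using card_inj_on_le[of f "{..<r}" C] card_C by simp
      qed
      then obtain i where i: "i < r" "a i \<inter> C = {}"
        by blast
      have nth: "ps n t ! j = (sorted_list_of_set (a j), W j t)" "length (ps n t) = r" if "j < r" for j t
        using that by (simp_all add: ps_def r_def del: upt_Suc)
      have "H \<beta> \<alpha> = Some (prod_encode (n, i))" if "\<beta> \<in> b" "\<alpha> \<in> a i" for \<beta> \<alpha>
      proof -
        have \<alpha>: "\<alpha> \<in> cov (D n \<beta>)"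
          using that i(1) unfolding D[OF that(1)] cov_ps r_def by blast
        have 1: "(LEAST n. \<alpha> \<in> cov (D n \<beta>)) = n"
        proof (rule Least_equality)
          show "\<alpha> \<in> cov (D n \<beta>)"
            by (rule \<alpha>)
          fix m assume "\<alpha> \<in> cov (D m \<beta>)"
          then show "n \<le> m"
            using i(2) that by (auto simp: C_def not_less[symmetric])
        qed
        have 2: "(LEAST t. t < length (D n \<beta>) \<and> \<alpha> \<in> set (fst (D n \<beta> ! t))) = i"
          unfolding D[OF that(1)]
        proof (rule Least_equality)
          show "i < length (ps n (h \<beta>)) \<and> \<alpha> \<in> set (fst (ps n (h \<beta>) ! i))"
            using i(1) that(2) by (simp add: nth a)
          fix t assume "t < length (ps n (h \<beta>)) \<and> \<alpha> \<in> set (fst (ps n (h \<beta>) ! t))"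
          then have "\<alpha> \<in> a i \<inter> a t"
            using that(2) i(1) nth by (auto simp: a)
          then have "i = t"
            using disj unfolding disjoint_family_on_def by blast
          then show "i \<le> t"
            by simp
        qed
        show ?thesis
          using \<alpha> unfolding H_def Let_def 1 2 by auto
      qed
      then show ?thesis
        using i(1) by (intro exI[of _ i] exI[of _ "prod_encode (n, i)"])
          (auto simp: A_def w_def D nth a)
    qed
    then show "\<exists>\<beta>0. \<forall>b h. finite b \<and> (\<forall>\<beta>\<in>b. \<beta>0 < \<beta>) \<longrightarrow>
        (\<exists>i \<iota>. \<forall>\<beta>\<in>b. A \<beta> \<iota> = a i \<and> w \<beta> \<iota> = W i (h \<beta>) \<and> (\<forall>\<alpha>\<in>a i. H \<beta> \<alpha> = Some \<iota>))"
      by blast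
  qed
qed

section \<open>Colorings\<close>

lemma disjoint_sequence_in:
  assumes "infinite \<A>" "disjoint \<A>"
  shows "\<exists>a :: nat \<Rightarrow> 'a set. range a \<subseteq> \<A> \<and> disjoint_family a"
proof -
  obtain a :: "nat \<Rightarrow> 'a set" where "inj a" "range a \<subseteq> \<A>"
    using infinite_countable_subset[OF assms(1)] by blast
  then have "disjoint_family a"
    unfolding disjoint_family_on_def
    using assms(2) by (metis disjointD injD range_subsetD)
  then show ?thesis
    using \<open>range a \<subseteq> \<A>\<close> by blast
qed

text \<open>Colouring \<alpha> by the label and the index of its block confines a colour class to
  one finite block. Were every \<open>a i\<close> to fail for some \<delta>, these failing values
  would serve as labels, and the block guessed at a high member of \<B> would not fail.\<close>

lemma fiber_coloring_if_guessing:
  assumes "guessing g"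
  shows "\<exists>c :: omega1 \<Rightarrow> omega1 \<Rightarrow> omega1 \<times> nat.
      finite_to_one_fibers c \<and>
      (\<forall>k \<A> l \<B>.
        \<A> \<subseteq> k_subsets k \<and> infinite \<A> \<and> disjoint \<A> \<and>
        \<B> \<subseteq> k_subsets l \<and> uncountable \<B> \<and> disjoint \<B> \<longrightarrow>
        (\<exists>a\<in>\<A>. \<forall>\<delta>. \<exists>\<iota>. \<exists>b\<in>\<B>. \<forall>\<beta>\<in>b. {\<alpha>. \<alpha> < \<beta> \<and> c \<alpha> \<beta> = (\<delta>, \<iota>)} = a))"
proof -
  obtain H :: "omega1 \<Rightarrow> omega1 \<Rightarrow> nat option"
    and A :: "omega1 \<Rightarrow> nat \<Rightarrow> omega1 set" and w :: "omega1 \<Rightarrow> nat \<Rightarrow> omega1"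
    where H: "\<And>\<beta> \<alpha> \<iota>. H \<beta> \<alpha> = Some \<iota> \<Longrightarrow> \<alpha> \<in> A \<beta> \<iota>"
    and A: "\<And>\<beta> \<iota>. finite (A \<beta> \<iota>)"
    and guess: "\<And>(a :: nat \<Rightarrow> omega1 set) k (W :: nat \<Rightarrow> nat \<Rightarrow> omega1).
      range a \<subseteq> k_subsets k \<Longrightarrow> disjoint_family a \<Longrightarrow>
      \<exists>\<beta>0. \<forall>b h. finite b \<and> (\<forall>\<beta>\<in>b. \<beta>0 < \<beta>) \<longrightarrow>
        (\<exists>i \<iota>. \<forall>\<beta>\<in>b. A \<beta> \<iota> = a i \<and> w \<beta> \<iota> = W i (h \<beta>) \<and> (\<forall>\<alpha>\<in>a i. H \<beta> \<alpha> = Some \<iota>))"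
    by (rule block_guessing[OF assms]) (rule that)
  \<comment> \<open>Parity separates the two cases: an \<alpha> mentioned by no block at \<beta> is
    coloured by itself, so such a colour occurs at most once below \<beta>.\<close>
  define c where "c \<alpha> \<beta> = (case H \<beta> \<alpha> of Some \<iota> \<Rightarrow> (w \<beta> \<iota>, 2 * \<iota>) | None \<Rightarrow> (\<alpha>, 1))" for \<alpha> \<beta>
  have c_odd: "\<alpha> = \<delta>" if "c \<alpha> \<beta> = (\<delta>, v)" "odd v" for \<alpha> \<beta> \<delta> v
    using that by (auto simp: c_def split: option.splits)
  have c_even: "H \<beta> \<alpha> = Some (v div 2)" if "c \<alpha> \<beta> = (\<delta>, v)" "even v" for \<alpha> \<beta> \<delta> v
    using that by (auto simp: c_def split: option.splits)
  have "finite {\<alpha>. \<alpha> < \<beta> \<and> c \<alpha> \<beta> = (\<delta>, v)}" for \<beta> \<delta> v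
  proof (cases "odd v")
    case True
    then have "{\<alpha>. \<alpha> < \<beta> \<and> c \<alpha> \<beta> = (\<delta>, v)} \<subseteq> {\<delta>}"
      using c_odd by auto
    then show ?thesis
      by (rule finite_subset) simp
  next
    case False
    then have "{\<alpha>. \<alpha> < \<beta> \<and> c \<alpha> \<beta> = (\<delta>, v)} \<subseteq> A \<beta> (v div 2)"
      using c_even H by auto
    then show ?thesis
      by (rule finite_subset) (rule A)
  qed
  then have fin: "finite_to_one_fibers c"
    by (simp add: finite_to_one_fibers_def)
  have main: "\<exists>a\<in>\<A>. \<forall>\<delta>. \<exists>\<iota>. \<exists>b\<in>\<B>. \<forall>\<beta>\<in>b. {\<alpha>. \<alpha> < \<beta> \<and> c \<alpha> \<beta> = (\<delta>, \<iota>)} = a"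
    if \<A>: "\<A> \<subseteq> k_subsets k" "infinite \<A>" "disjoint \<A>"
      and \<B>: "\<B> \<subseteq> k_subsets l" "uncountable \<B>" "disjoint \<B>" for k \<A> l \<B>
  proof (rule ccontr)
    assume neg: "\<not> ?thesis"
    obtain a :: "nat \<Rightarrow> omega1 set" where a: "range a \<subseteq> \<A>" "disjoint_family a"
      using disjoint_sequence_in[OF \<A>(2,3)] by blast
    define P where "P s \<delta> \<longleftrightarrow> (\<exists>\<iota>. \<exists>b\<in>\<B>. \<forall>\<beta>\<in>b. {\<alpha>. \<alpha> < \<beta> \<and> c \<alpha> \<beta> = (\<delta>, \<iota>)} = s)" for s \<delta>
    have "\<forall>s\<in>\<A>. \<exists>\<delta>. \<not> P s \<delta>"
      using neg unfolding P_def by simp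
    then have "\<forall>i. \<exists>\<delta>. \<not> P (a i) \<delta>"
      using a(1) by blast
    from choice[OF this] obtain \<delta> where \<delta>: "\<And>i. \<not> P (a i) (\<delta> i)"
      by blast
    have a_k: "range a \<subseteq> k_subsets k"
      using a(1) \<A>(1) by blast
    then have "finite (a i)" for i
      by (auto simp: k_subsets_def image_subset_iff)
    then have "countable (\<Union>i. a i)"
      by (intro countable_UN countableI_type countable_finite)
    from countable_omega1_bounded[OF this] obtain \<xi> where \<xi>: "\<forall>\<alpha>\<in>(\<Union>i. a i). \<alpha> < \<xi>" ..
    from guess[OF a_k a(2), of "\<lambda>i _. \<delta> i"] obtain \<beta>0 where
      \<beta>0: "\<forall>b (h :: omega1 \<Rightarrow> nat). finite b \<and> (\<forall>\<beta>\<in>b. \<beta>0 < \<beta>) \<longrightarrow>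
        (\<exists>i \<iota>. \<forall>\<beta>\<in>b. A \<beta> \<iota> = a i \<and> w \<beta> \<iota> = \<delta> i \<and> (\<forall>\<alpha>\<in>a i. H \<beta> \<alpha> = Some \<iota>))" ..
    obtain b where b: "b \<in> \<B>" "\<forall>\<beta>\<in>b. max \<beta>0 \<xi> < \<beta>"
      using disjoint_family_above[OF \<B>(2,3)] by blast
    moreover have "finite b"
      using b(1) \<B>(1) by (auto simp: k_subsets_def)
    ultimately obtain i \<iota> where
      "\<forall>\<beta>\<in>b. A \<beta> \<iota> = a i \<and> w \<beta> \<iota> = \<delta> i \<and> (\<forall>\<alpha>\<in>a i. H \<beta> \<alpha> = Some \<iota>)"
      using \<beta>0[rule_format, of b] by auto
    note i = bspec[OF this]
    \<comment> \<open>The class is no larger than the block because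
      \<open>H \<beta> \<alpha> = Some \<iota>\<close> forces \<alpha> into
      \<open>A \<beta> \<iota>\<close>.\<close>
    have "{\<alpha>. \<alpha> < \<beta> \<and> c \<alpha> \<beta> = (\<delta> i, 2 * \<iota>)} = a i" if "\<beta> \<in> b" for \<beta>
    proof (intro equalityI subsetI)
      fix \<alpha> assume "\<alpha> \<in> a i"
      moreover from this have "\<alpha> < \<beta>"
        using \<xi> b(2) that by force
      ultimately show "\<alpha> \<in> {\<alpha>. \<alpha> < \<beta> \<and> c \<alpha> \<beta> = (\<delta> i, 2 * \<iota>)}"
        using i[OF that] by (simp add: c_def)
    next
      fix \<alpha> assume "\<alpha> \<in> {\<alpha>. \<alpha> < \<beta> \<and> c \<alpha> \<beta> = (\<delta> i, 2 * \<iota>)}"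
      then have "H \<beta> \<alpha> = Some \<iota>"
        using c_even[of \<alpha> \<beta> "\<delta> i" "2 * \<iota>"] by simp
      then show "\<alpha> \<in> a i"
        using H i[OF that] by blast
    qed
    then have "P (a i) (\<delta> i)"
      unfolding P_def using b(1) by (intro exI[of _ "2 * \<iota>"] bexI[of _ b]) auto
    then show False
      using \<delta> by blast
  qed
  show ?thesis
    by (intro exI[of _ c] conjI allI impI fin) (elim conjE, rule main)
qed

lemma nth_elem_in: "a \<in> k_subsets k \<Longrightarrow> n < k \<Longrightarrow> nth_elem a n \<in> a"
  using nth_mem[of n "sorted_list_of_set a"] by (simp add: nth_elem_def k_subsets_def)

lemma nth_elem_eq_iff:
  "a \<in> k_subsets k \<Longrightarrow> n < k \<Longrightarrow> m < k \<Longrightarrow> nth_elem a n = nth_elem a m \<longleftrightarrow> n = m"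
  by (simp add: nth_elem_def k_subsets_def nth_eq_iff_index_eq)

text \<open>The label of a block is a table of triples: a point \<alpha>, a possible value of
  \<open>p \<alpha> \<beta>\<close>, and the colour to use. Labels are fixed before \<beta> is
  known; coherence bounds \<open>p \<alpha> \<beta>\<close> by \<open>p \<alpha> \<xi>\<close> plus
  a constant depending on \<beta> only, so finite tables are enough.\<close>

lemma matrix_coloring_if_guessing:
  assumes "guessing g" and p: "linf_coherent p"
  shows "\<exists>d :: omega1 \<Rightarrow> omega1 \<Rightarrow> omega1.
    \<forall>k \<A> l \<B>.
      \<A> \<subseteq> k_subsets k \<and> infinite \<A> \<and> disjoint \<A> \<and>
      \<B> \<subseteq> k_subsets l \<and> uncountable \<B> \<and> disjoint \<B> \<longrightarrow>
      (\<exists>a\<in>\<A>. \<forall>\<tau> :: nat \<Rightarrow> nat \<Rightarrow> nat \<Rightarrow> omega1. \<exists>b\<in>\<B>. \<forall>n<k. \<forall>m<l.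
        nth_elem a n < nth_elem b m \<and>
        d (nth_elem a n) (nth_elem b m) = \<tau> n m (p (nth_elem a n) (nth_elem b m)))"
proof -
  obtain H :: "omega1 \<Rightarrow> omega1 \<Rightarrow> nat option"
    and A :: "omega1 \<Rightarrow> nat \<Rightarrow> omega1 set" and w :: "omega1 \<Rightarrow> nat \<Rightarrow> omega1"
    where "\<And>\<beta> \<alpha> \<iota>. H \<beta> \<alpha> = Some \<iota> \<Longrightarrow> \<alpha> \<in> A \<beta> \<iota>" "\<And>\<beta> \<iota>. finite (A \<beta> \<iota>)"
    and guess: "\<And>(a :: nat \<Rightarrow> omega1 set) k (W :: nat \<Rightarrow> nat \<Rightarrow> omega1).
      range a \<subseteq> k_subsets k \<Longrightarrow> disjoint_family a \<Longrightarrow>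
      \<exists>\<beta>0. \<forall>b h. finite b \<and> (\<forall>\<beta>\<in>b. \<beta>0 < \<beta>) \<longrightarrow>
        (\<exists>i \<iota>. \<forall>\<beta>\<in>b. A \<beta> \<iota> = a i \<and> w \<beta> \<iota> = W i (h \<beta>) \<and> (\<forall>\<alpha>\<in>a i. H \<beta> \<alpha> = Some \<iota>))"
    by (rule block_guessing[OF assms(1)]) (rule that)
  obtain L :: "omega1 list \<Rightarrow> omega1" where L: "inj L"
    using omega1_list_into_omega1 by blast
  obtain ord :: "nat \<Rightarrow> omega1" where ord: "inj ord"
    using nat_into_omega1 by blast
  define d where "d \<alpha> \<beta> = (SOME u. L [\<alpha>, ord (p \<alpha> \<beta>), u] \<in> set (inv L (w \<beta> (the (H \<beta> \<alpha>)))))" for \<alpha> \<beta>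
  have main: "\<exists>a\<in>\<A>. \<forall>\<tau> :: nat \<Rightarrow> nat \<Rightarrow> nat \<Rightarrow> omega1. \<exists>b\<in>\<B>. \<forall>n<k. \<forall>m<l.
        nth_elem a n < nth_elem b m \<and>
        d (nth_elem a n) (nth_elem b m) = \<tau> n m (p (nth_elem a n) (nth_elem b m))"
    if \<A>: "\<A> \<subseteq> k_subsets k" "infinite \<A>" "disjoint \<A>"
      and \<B>: "\<B> \<subseteq> k_subsets l" "uncountable \<B>" "disjoint \<B>" for k \<A> l \<B>
  proof (rule ccontr)
    assume neg: "\<not> ?thesis"
    obtain a :: "nat \<Rightarrow> omega1 set" where a: "range a \<subseteq> \<A>" "disjoint_family a"
      using disjoint_sequence_in[OF \<A>(2,3)] by blast
    define P where "P s \<tau> \<longleftrightarrow> (\<exists>b\<in>\<B>. \<forall>n<k. \<forall>m<l. nth_elem s n < nth_elem b m \<and>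
      d (nth_elem s n) (nth_elem b m) = \<tau> n m (p (nth_elem s n) (nth_elem b m)))"
      for s and \<tau> :: "nat \<Rightarrow> nat \<Rightarrow> nat \<Rightarrow> omega1"
    have "\<not> (\<exists>s\<in>\<A>. \<forall>\<tau>. P s \<tau>)"
      using neg unfolding P_def .
    then have "\<forall>i. \<exists>\<tau>. \<not> P (a i) \<tau>"
      using a(1) by blast
    from choice[OF this] obtain \<tau> where \<tau>: "\<And>i. \<not> P (a i) (\<tau> i)"
      by blast
    have a_k: "range a \<subseteq> k_subsets k"
      using a(1) \<A>(1) by blast
    then have "finite (a i)" for i
      by (auto simp: k_subsets_def image_subset_iff)
    then have "countable (\<Union>i. a i)"
      by (intro countable_UN countableI_type countable_finite)
    from countable_omega1_bounded[OF this] obtain \<xi> where \<xi>: "\<forall>\<alpha>\<in>(\<Union>i. a i). \<alpha> < \<xi>" ..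
    \<comment> \<open>The index \<open>t\<close> codes the column \<open>m\<close> and the constant
      \<open>N\<close> that bounds the table; both belong to \<beta> and are supplied through
      \<open>h\<close>.\<close>
    define W where "W i t = (let (m, N) = prod_decode t in
      L (concat (map (\<lambda>n. map (\<lambda>v. L [nth_elem (a i) n, ord v, \<tau> i n m v])
        [0..<Suc (p (nth_elem (a i) n) \<xi> + N)]) [0..<k])))" for i t
    from guess[OF a_k a(2), of W] obtain \<beta>0 where
      \<beta>0: "\<forall>b h. finite b \<and> (\<forall>\<beta>\<in>b. \<beta>0 < \<beta>) \<longrightarrow>
        (\<exists>i \<iota>. \<forall>\<beta>\<in>b. A \<beta> \<iota> = a i \<and> w \<beta> \<iota> = W i (h \<beta>) \<and> (\<forall>\<alpha>\<in>a i. H \<beta> \<alpha> = Some \<iota>))" ..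
    obtain b where b: "b \<in> \<B>" "\<forall>\<beta>\<in>b. max \<beta>0 \<xi> < \<beta>"
      using disjoint_family_above[OF \<B>(2,3)] by blast
    have b_l: "b \<in> k_subsets l" and fin_b: "finite b"
      using b(1) \<B>(1) by (auto simp: k_subsets_def)
    have "\<forall>\<beta>\<in>b. \<exists>N. \<forall>\<alpha><\<xi>. p \<alpha> \<beta> \<le> p \<alpha> \<xi> + N"
    proof
      fix \<beta> assume "\<beta> \<in> b"
      then have "finite {int (p \<alpha> \<xi>) - int (p \<alpha> \<beta>) | \<alpha>. \<alpha> < \<xi>}"
        using p b(2) unfolding linf_coherent_def by simp
      from finite_imageI[OF this, of "\<lambda>z. nat (- z)"]
      obtain N where N: "\<forall>z\<in>(\<lambda>z. nat (- z)) ` {int (p \<alpha> \<xi>) - int (p \<alpha> \<beta>) | \<alpha>. \<alpha> < \<xi>}. z \<le> N"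
        unfolding finite_nat_set_iff_bounded_le by blast
      have "p \<alpha> \<beta> \<le> p \<alpha> \<xi> + N" if "\<alpha> < \<xi>" for \<alpha>
      proof -
        have "nat (- (int (p \<alpha> \<xi>) - int (p \<alpha> \<beta>))) \<le> N"
          using N that by blast
        then show ?thesis by linarith
      qed
      then show "\<exists>N. \<forall>\<alpha><\<xi>. p \<alpha> \<beta> \<le> p \<alpha> \<xi> + N"
        by blast
    qed
    from bchoice[OF this] obtain N0 where N0: "\<And>\<beta> \<alpha>. \<beta> \<in> b \<Longrightarrow> \<alpha> < \<xi> \<Longrightarrow> p \<alpha> \<beta> \<le> p \<alpha> \<xi> + N0 \<beta>"
      by blast
    define h where "h \<beta> = prod_encode (SOME m. m < l \<and> nth_elem b m = \<beta>, N0 \<beta>)" for \<beta>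
    have h: "h (nth_elem b m) = prod_encode (m, N0 (nth_elem b m))" if "m < l" for m
    proof -
      have "(SOME m'. m' < l \<and> nth_elem b m' = nth_elem b m) = m"
        by (rule some_equality) (use that nth_elem_eq_iff[OF b_l] in auto)
      then show ?thesis
        by (simp add: h_def)
    qed
    obtain i \<iota> where
      "\<forall>\<beta>\<in>b. A \<beta> \<iota> = a i \<and> w \<beta> \<iota> = W i (h \<beta>) \<and> (\<forall>\<alpha>\<in>a i. H \<beta> \<alpha> = Some \<iota>)"
      using \<beta>0[rule_format, of b h] fin_b b(2) by auto
    note i = bspec[OF this]
    have ai: "a i \<in> k_subsets k"
      using a_k by blast
    have "P (a i) (\<tau> i)"
      unfolding P_def
    proof (intro bexI[OF _ b(1)] allI impI)
      fix n m assume n: "n < k" and m: "m < l"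
      let ?\<alpha> = "nth_elem (a i) n" and ?\<beta> = "nth_elem b m"
      have \<alpha>: "?\<alpha> \<in> a i" and \<beta>: "?\<beta> \<in> b"
        using nth_elem_in ai b_l n m by blast+
      have less: "?\<alpha> < \<xi>" "\<xi> < ?\<beta>"
        using \<xi> \<alpha> \<beta> b(2) by auto
      have w: "inv L (w ?\<beta> (the (H ?\<beta> ?\<alpha>))) =
          concat (map (\<lambda>n. map (\<lambda>v. L [nth_elem (a i) n, ord v, \<tau> i n m v])
            [0..<Suc (p (nth_elem (a i) n) \<xi> + N0 ?\<beta>)]) [0..<k])"
        using i[OF \<beta>] \<alpha> by (simp add: h[OF m] W_def inv_f_f[OF L] del: upt_Suc)
      \<comment> \<open>Injectivity of \<open>L\<close>, of \<open>ord\<close> and of the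
        enumeration of \<open>a i\<close> leaves exactly one colour for the choice in
        \<open>d\<close>.\<close>
      have iff: "L [?\<alpha>, ord (p ?\<alpha> ?\<beta>), u] \<in> set (inv L (w ?\<beta> (the (H ?\<beta> ?\<alpha>))))
          \<longleftrightarrow> u = \<tau> i n m (p ?\<alpha> ?\<beta>)" (is "?l \<longleftrightarrow> ?r") for u
      proof
        assume ?l
        then obtain n' v where "n' < k" "L [?\<alpha>, ord (p ?\<alpha> ?\<beta>), u] = L [nth_elem (a i) n', ord v, \<tau> i n' m v]"
          unfolding w by auto
        then show ?r
          using injD[OF L] injD[OF ord] nth_elem_eq_iff[OF ai n] by fastforce
      next
        assume ?r
        moreover have "p ?\<alpha> ?\<beta> \<in> set [0..<Suc (p ?\<alpha> \<xi> + N0 ?\<beta>)]"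
          using N0[OF \<beta> less(1)] by auto
        ultimately show ?l
          unfolding w set_concat set_map image_image using n
          by (intro UN_I[of n] image_eqI[of _ _ "p ?\<alpha> ?\<beta>"]) simp_all
      qed
      have "d ?\<alpha> ?\<beta> = \<tau> i n m (p ?\<alpha> ?\<beta>)"
        unfolding d_def iff by simp
      then show "?\<alpha> < ?\<beta> \<and> d ?\<alpha> ?\<beta> = \<tau> i n m (p ?\<alpha> ?\<beta>)"
        using less by auto
    qed
    then show False
      using \<tau> by blast
  qed
  show ?thesis
    by (intro exI[of _ d] allI impI) (elim conjE, rule main)
qed

section \<open>From the colorings back to families of reals\<close>

lemma uncountable_singletons: "uncountable B \<Longrightarrow> uncountable ((\<lambda>\<beta>. {\<beta>}) ` B)"
  by (simp add: countable_image_inj_eq)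

text \<open>On singletons, each \<delta> is the first coordinate of a colour of the selected
  \<alpha>, and \<open>inv ord\<close> maps \<open>omega1\<close> onto the naturals.\<close>

lemma all_colors_if_fiber_coloring:
  fixes c :: "omega1 \<Rightarrow> omega1 \<Rightarrow> omega1 \<times> nat"
  assumes c: "\<And>k \<A> l \<B>.
      \<A> \<subseteq> k_subsets k \<and> infinite \<A> \<and> disjoint \<A> \<and>
      \<B> \<subseteq> k_subsets l \<and> uncountable \<B> \<and> disjoint \<B> \<Longrightarrow>
      \<exists>a\<in>\<A>. \<forall>\<delta>. \<exists>\<iota>. \<exists>b\<in>\<B>. \<forall>\<beta>\<in>b. {\<alpha>. \<alpha> < \<beta> \<and> c \<alpha> \<beta> = (\<delta>, \<iota>)} = a"
  shows "\<exists>e :: omega1 \<Rightarrow> omega1 \<Rightarrow> nat. \<forall>A B. infinite A \<and> uncountable B \<longrightarrow>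
    (\<exists>\<alpha>\<in>A. {e \<alpha> \<beta> | \<beta>. \<beta> \<in> B \<and> \<alpha> < \<beta>} = UNIV)"
proof -
  obtain ord :: "nat \<Rightarrow> omega1" where ord: "inj ord"
    using nat_into_omega1 by blast
  have "\<exists>\<alpha>\<in>A. {inv ord (fst (c \<alpha> \<beta>)) | \<beta>. \<beta> \<in> B \<and> \<alpha> < \<beta>} = UNIV"
    if AB: "infinite A" "uncountable B" for A B
  proof -
    let ?\<A> = "(\<lambda>\<beta>. {\<beta>}) ` A" and ?\<B> = "(\<lambda>\<beta>. {\<beta>}) ` B"
    have "\<exists>a\<in>?\<A>. \<forall>\<delta>. \<exists>\<iota>. \<exists>b\<in>?\<B>. \<forall>\<beta>\<in>b. {\<alpha>. \<alpha> < \<beta> \<and> c \<alpha> \<beta> = (\<delta>, \<iota>)} = a"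
      by (rule c[of _ 1 _ 1])
        (use AB uncountable_singletons in \<open>auto simp: k_subsets_def disjoint_def finite_image_iff\<close>)
    then obtain \<alpha> where \<alpha>: "\<alpha> \<in> A"
      "\<And>\<delta>. \<exists>\<iota>. \<exists>\<beta>\<in>B. {\<alpha>'. \<alpha>' < \<beta> \<and> c \<alpha>' \<beta> = (\<delta>, \<iota>)} = {\<alpha>}"
      by auto
    have "v \<in> {inv ord (fst (c \<alpha> \<beta>)) | \<beta>. \<beta> \<in> B \<and> \<alpha> < \<beta>}" for v
    proof -
      obtain \<iota> \<beta> where "\<beta> \<in> B" "{\<alpha>'. \<alpha>' < \<beta> \<and> c \<alpha>' \<beta> = (ord v, \<iota>)} = {\<alpha>}"
        using \<alpha>(2) by blast
      then have "\<beta> \<in> B" "\<alpha> < \<beta>" "c \<alpha> \<beta> = (ord v, \<iota>)"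
        by auto
      then show ?thesis
        by (intro CollectI exI[of _ \<beta>]) (simp add: inv_f_f[OF ord])
    qed
    then show ?thesis
      using \<alpha>(1) by blast
  qed
  then show ?thesis
    by (intro exI[of _ "\<lambda>\<alpha> \<beta>. inv ord (fst (c \<alpha> \<beta>))"]) blast
qed

text \<open>Singletons and constant \<tau> turn the matrix condition into a single \<alpha>
  receiving every colour.\<close>

lemma all_colors_if_matrix_coloring:
  fixes d :: "omega1 \<Rightarrow> omega1 \<Rightarrow> omega1"
  assumes d: "\<And>k \<A> l \<B>.
      \<A> \<subseteq> k_subsets k \<and> infinite \<A> \<and> disjoint \<A> \<and>
      \<B> \<subseteq> k_subsets l \<and> uncountable \<B> \<and> disjoint \<B> \<Longrightarrow>
      \<exists>a\<in>\<A>. \<forall>\<tau> :: nat \<Rightarrow> nat \<Rightarrow> nat \<Rightarrow> omega1. \<exists>b\<in>\<B>. \<forall>n<k. \<forall>m<l.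
        nth_elem a n < nth_elem b m \<and>
        d (nth_elem a n) (nth_elem b m) = \<tau> n m (p (nth_elem a n) (nth_elem b m))"
  shows "\<exists>e :: omega1 \<Rightarrow> omega1 \<Rightarrow> nat. \<forall>A B. infinite A \<and> uncountable B \<longrightarrow>
    (\<exists>\<alpha>\<in>A. {e \<alpha> \<beta> | \<beta>. \<beta> \<in> B \<and> \<alpha> < \<beta>} = UNIV)"
proof -
  obtain ord :: "nat \<Rightarrow> omega1" where ord: "inj ord"
    using nat_into_omega1 by blast
  have "\<exists>\<alpha>\<in>A. {inv ord (d \<alpha> \<beta>) | \<beta>. \<beta> \<in> B \<and> \<alpha> < \<beta>} = UNIV"
    if AB: "infinite A" "uncountable B" for A B
  proof -
    let ?\<A> = "(\<lambda>\<beta>. {\<beta>}) ` A" and ?\<B> = "(\<lambda>\<beta>. {\<beta>}) ` B"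
    have "\<exists>a\<in>?\<A>. \<forall>\<tau> :: nat \<Rightarrow> nat \<Rightarrow> nat \<Rightarrow> omega1. \<exists>b\<in>?\<B>. \<forall>n<1. \<forall>m<1.
        nth_elem a n < nth_elem b m \<and>
        d (nth_elem a n) (nth_elem b m) = \<tau> n m (p (nth_elem a n) (nth_elem b m))"
      by (rule d) (use AB uncountable_singletons in \<open>auto simp: k_subsets_def disjoint_def finite_image_iff\<close>)
    then obtain \<alpha> where \<alpha>: "\<alpha> \<in> A"
      "\<And>\<tau> :: nat \<Rightarrow> nat \<Rightarrow> nat \<Rightarrow> omega1. \<exists>\<beta>\<in>B. \<alpha> < \<beta> \<and> d \<alpha> \<beta> = \<tau> 0 0 (p \<alpha> \<beta>)"
      by (auto simp: nth_elem_def)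
    have "v \<in> {inv ord (d \<alpha> \<beta>) | \<beta>. \<beta> \<in> B \<and> \<alpha> < \<beta>}" for v
    proof -
      obtain \<beta> where "\<beta> \<in> B" "\<alpha> < \<beta>" "d \<alpha> \<beta> = ord v"
        using \<alpha>(2)[of "\<lambda>_ _ _. ord v"] by blast
      then show ?thesis
        by (intro CollectI exI[of _ \<beta>]) (simp add: inv_f_f[OF ord])
    qed
    then show ?thesis
      using \<alpha>(1) by blast
  qed
  then show ?thesis
    by (intro exI[of _ "\<lambda>\<alpha> \<beta>. inv ord (d \<alpha> \<beta>)"]) blast
qed

text \<open>The colours \<open>e (ord n) \<beta>\<close> are read as the real
  \<open>x \<beta>\<close>. If \<open>y\<close> agreed with each only finitely often on
  \<open>M\<close>, an uncountable set would share a bound \<open>K\<close>; for it and the points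
  \<open>ord n\<close> with \<open>n \<in> M\<close>, \<open>n \<ge> K\<close>, the coloring yields
  an agreement not below \<open>K\<close>.\<close>

lemma infinitely_often_equal_on_infinite_if_all_colors:
  fixes e :: "omega1 \<Rightarrow> omega1 \<Rightarrow> nat"
  assumes e: "\<And>A B. infinite A \<and> uncountable B \<Longrightarrow> \<exists>\<alpha>\<in>A. {e \<alpha> \<beta> | \<beta>. \<beta> \<in> B \<and> \<alpha> < \<beta>} = UNIV"
  shows "\<exists>x :: omega1 \<Rightarrow> nat \<Rightarrow> nat. \<forall>M y. infinite M \<longrightarrow> (\<exists>\<beta>. infinite {n \<in> M. x \<beta> n = y n})"
proof -
  obtain ord :: "nat \<Rightarrow> omega1" where ord: "inj ord"
    using nat_into_omega1 by blast
  have "\<exists>\<beta>. infinite {n \<in> M. e (ord n) \<beta> = y n}" if M: "infinite M" for M and y :: "nat \<Rightarrow> nat"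
  proof (rule ccontr)
    assume "\<not> ?thesis"
    then have "\<forall>\<beta>. \<exists>N. \<forall>n\<in>{n \<in> M. e (ord n) \<beta> = y n}. n < N"
      unfolding finite_nat_set_iff_bounded by blast
    from choice[OF this] obtain N where N: "\<And>\<beta> n. n \<in> M \<Longrightarrow> e (ord n) \<beta> = y n \<Longrightarrow> n < N \<beta>"
      by blast
    obtain K where K: "uncountable {\<beta>. N \<beta> = K}"
      using uncountable_fiber[OF uncountable_UNIV_omega1, of N] by auto
    have "infinite (ord ` (M - {..<K}))"
      using M ord by (subst finite_image_iff) (auto intro: inj_on_subset)
    from e[OF conjI[OF this K]] obtain n where "n \<in> M - {..<K}" and
      n_UNIV: "{e (ord n) \<beta> | \<beta>. \<beta> \<in> {\<beta>. N \<beta> = K} \<and> ord n < \<beta>} = UNIV"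
      by blast
    then have n: "n \<in> M" "K \<le> n"
      by auto
    have "y n \<in> {e (ord n) \<beta> | \<beta>. \<beta> \<in> {\<beta>. N \<beta> = K} \<and> ord n < \<beta>}"
      unfolding n_UNIV by simp
    then obtain \<beta> where "N \<beta> = K" "e (ord n) \<beta> = y n"
      by auto
    then show False
      using N[OF n(1)] n(2) by fastforce
  qed
  then show ?thesis
    by (intro exI[of _ "\<lambda>\<beta> n. e (ord n) \<beta>"]) blast
qed

section \<open>Nonmeager sets of reals\<close>

lemma countable_meager_real:
  assumes "countable (X :: real set)"
  shows "meager X"
proof (cases "X = {}")
  case True
  then show ?thesis
    unfolding meager_def by (intro exI[of _ "\<lambda>_. {}"]) (simp add: nowhere_dense_def)
next
  case False
  then obtain f :: "nat \<Rightarrow> real" where "X = range f"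
    using assms uncountable_def by blast
  then show ?thesis
    unfolding meager_def by (intro exI[of _ "\<lambda>n. {f n}"]) (auto simp: nowhere_dense_def)
qed

lemma nowhere_dense_realI:
  assumes "\<And>a b :: real. a < b \<Longrightarrow> \<exists>c d. a \<le> c \<and> c < d \<and> d \<le> b \<and> {c<..<d} \<inter> S = {}"
  shows "nowhere_dense S"
proof (rule ccontr)
  assume "\<not> nowhere_dense S"
  then obtain t where t: "t \<in> interior (closure S)"
    unfolding nowhere_dense_def by blast
  then obtain r where r: "r > 0" "cball t r \<subseteq> interior (closure S)"
    using open_contains_cball_eq[OF open_interior] by blast
  obtain c d where cd: "t \<le> c" "c < d" "d \<le> t + r" "{c<..<d} \<inter> S = {}"
    using assms[of t "t + r"] r(1) by auto
  have "{c<..<d} \<inter> closure S = {}"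
    using cd(4) by (subst open_Int_closure_eq_empty) auto
  moreover have "(c + d) / 2 \<in> cball t r" "(c + d) / 2 \<in> {c<..<d}"
    using cd(1-3) r(1) by (auto simp: dist_real_def field_simps)
  ultimately show False
    using r(2) interior_subset[of "closure S"] by blast
qed

text \<open>Passing to closures makes the finite union closed, still with empty interior, so what it
  leaves of the interval is open and nonempty.\<close>

lemma nowhere_dense_avoid:
  fixes N :: "nat \<Rightarrow> real set"
  assumes N: "\<And>i. nowhere_dense (N i)" and "a < b"
  shows "\<exists>c d. a < c \<and> c < d \<and> d < b \<and> {c..d} \<inter> (\<Union>i\<le>n. N i) = {}"
proof -
  have "interior (\<Union>i\<le>n. closure (N i)) = {}"
  proof (induction n)
    case 0
    then show ?case using N[of 0] by (simp add: nowhere_dense_def)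
  next
    case (Suc n)
    have "closed (\<Union>i\<le>n. closure (N i))"
      by (intro closed_UN) auto
    with Suc N[of "Suc n"] show ?case
      by (simp add: atMost_Suc nowhere_dense_def interior_closed_Un_empty_interior)
  qed
  then have "\<not> {a<..<b} \<subseteq> (\<Union>i\<le>n. closure (N i))"
    using interior_maximal[of "{a<..<b}" "\<Union>i\<le>n. closure (N i)"] \<open>a < b\<close> by auto
  then obtain t where t: "t \<in> {a<..<b} - (\<Union>i\<le>n. closure (N i))"
    by blast
  define U where "U = {a<..<b} - (\<Union>i\<le>n. closure (N i))"
  have "open U"
    unfolding U_def by (intro open_Diff closed_UN) auto
  then obtain r where r: "r > 0" "cball t r \<subseteq> U"
    using open_contains_cball_eq[of U] t[folded U_def] by blast
  then have sub: "{t - r..t + r} \<subseteq> U"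
    by (simp add: cball_eq_atLeastAtMost)
  have "t - r \<in> U" "t + r \<in> U"
    using r(1) by (auto intro: subsetD[OF sub])
  then have "t - r \<in> {a<..<b}" "t + r \<in> {a<..<b}"
    unfolding U_def by blast+
  moreover have "U \<inter> (\<Union>i\<le>n. N i) = {}"
    unfolding U_def by (auto dest: subsetD[OF closure_subset])
  then have "{t - r..t + r} \<inter> (\<Union>i\<le>n. N i) = {}"
    using sub by blast
  ultimately show ?thesis
    using r(1) by (intro exI[of _ "t - r"] exI[of _ "t + r"]) auto
qed

section \<open>Coded intervals and growth rates\<close>

lemma countable_interval_base:
  obtains lo hi :: "nat \<Rightarrow> real"
  where "\<And>q. lo q < hi q" and "\<And>a b. a < b \<Longrightarrow> \<exists>q. a < lo q \<and> hi q < b"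
proof -
  \<comment> \<open>A pair in the wrong order codes an interval of length 1, so every
    \<open>q\<close> names a nondegenerate interval.\<close>
  define lo hi :: "nat \<Rightarrow> real" where
    "lo q = of_rat (fst (from_nat q :: rat \<times> rat))" and
    "hi q = (let (r, s) = (from_nat q :: rat \<times> rat) in if r < s then of_rat s else of_rat r + 1)" for q
  show thesis
  proof (rule that[of lo hi])
    show "lo q < hi q" for q
      by (auto simp: lo_def hi_def of_rat_less split: prod.split)
    fix a b :: real assume "a < b"
    then obtain r where r: "a < of_rat r" "of_rat r < b"
      using of_rat_dense by blast
    then obtain s where s: "of_rat r < (of_rat s :: real)" "of_rat s < b"
      using of_rat_dense by blast
    show "\<exists>q. a < lo q \<and> hi q < b"
      using r s by (intro exI[of _ "to_nat (r, s)"]) (auto simp: lo_def hi_def of_rat_less)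
  qed
qed

text \<open>A strictly increasing function above \<open>u\<close>, so that an arbitrary guessed
  \<open>u\<close> can serve as a growth rate.\<close>

definition growth :: "(nat \<Rightarrow> nat) \<Rightarrow> nat \<Rightarrow> nat" where
  "growth u n = (\<Sum>i\<le>n. Suc (u i))"

lemma growth_Suc: "growth u (Suc n) = growth u n + Suc (u (Suc n))"
  by (simp add: growth_def)

lemma less_growth: "u n < growth u n"
  by (cases n) (simp_all add: growth_def)

text \<open>If the growth stays bounded by \<open>F\<close> from \<open>n0\<close> on, it stays
  below the iterates \<open>G\<close> up to a fixed shift of the index. The target runs through
  these iterates at double speed, so an agreement at a late \<open>n\<close> breaks that
  bound.\<close>

lemma growth_outpaces:
  fixes F :: "nat \<Rightarrow> nat"
  assumes F: "mono F" "\<And>c. c \<le> F c"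
  shows "\<exists>y. \<forall>u. infinite {n. u n = y n} \<longrightarrow> infinite {n. F (growth u n) < growth u (Suc n)}"
proof -
  define G where "G = rec_nat 0 (\<lambda>_ m. Suc (F m))"
  have G_Suc: "G (Suc n) = Suc (F (G n))" for n
    by (simp add: G_def)
  have "G n < G (Suc n)" for n
    using F(2)[of "G n"] by (simp add: G_Suc)
  then have G: "strict_mono G"
    by (simp add: strict_mono_Suc_iff)
  have "infinite {n. F (growth u n) < growth u (Suc n)}"
    if u: "infinite {n. u n = Suc (G (2 * n))}" for u
  proof
    assume "finite {n. F (growth u n) < growth u (Suc n)}"
    then obtain n0 where "\<And>n. F (growth u n) < growth u (Suc n) \<Longrightarrow> n < n0"
      unfolding finite_nat_set_iff_bounded by blast
    then have n0: "growth u (Suc n) \<le> F (growth u n)" if "n0 \<le> n" for n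
      using that by (meson not_le)
    define c where "c = growth u n0"
    have bound: "growth u (n0 + i) \<le> G (c + i)" for i
    proof (induction i)
      case 0
      then show ?case
        using strict_mono_imp_increasing[OF G, of c] by (simp add: c_def)
    next
      case (Suc i)
      have "growth u (n0 + Suc i) \<le> F (growth u (n0 + i))"
        using n0[of "n0 + i"] by simp
      also have "\<dots> \<le> F (G (c + i))"
        using F(1) Suc.IH by (rule monoD)
      also have "\<dots> \<le> G (c + Suc i)"
        by (simp add: G_Suc)
      finally show ?case .
    qed
    obtain n where n: "n0 + c \<le> n" "u n = Suc (G (2 * n))"
      using u unfolding infinite_nat_iff_unbounded_le by blast
    have "G (2 * n) < growth u n"
      using less_growth[of u n] n(2) by simp
    also have "\<dots> \<le> G (c + (n - n0))"
      using bound[of "n - n0"] n(1) by simp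
    also have "\<dots> \<le> G (2 * n)"
      using n(1) strict_mono_less_eq[OF G] by simp
    finally show False by simp
  qed
  then show ?thesis
    by (intro exI[of _ "\<lambda>n. Suc (G (2 * n))"]) blast
qed

text \<open>
  \<open>v n\<close> is read as a list of reactions to all the possible positions \<open>q < g n\<close>, so that one
  correct guess works whatever the earlier guesses were.
\<close>

primrec branch :: "(nat \<Rightarrow> real) \<Rightarrow> (nat \<Rightarrow> real) \<Rightarrow> (nat \<Rightarrow> nat) \<Rightarrow> (nat \<Rightarrow> nat) \<Rightarrow> nat \<Rightarrow> nat" where
  "branch lo hi g v 0 = 0"
| "branch lo hi g v (Suc n) =
    (let q = branch lo hi g v n; q' = list_decode (v n) ! q
     in if lo q \<le> lo q' \<and> hi q' \<le> hi q \<and> q' < g (Suc n) then q' else q)"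

text \<open>The test in \<open>branch\<close> enforces this also after wrong guesses. It puts every
  position inside a list of length \<open>g n\<close>, so a correct guess always has an entry for
  it.\<close>

lemma branch_less:
  assumes "\<And>n. g n < g (Suc n)" "0 < g 0"
  shows "branch lo hi g v n < g n"
proof (induction n)
  case (Suc n)
  then show ?case
    using assms(1)[of n] by (auto simp: Let_def)
qed (simp add: assms)

text \<open>The test in \<open>branch\<close> keeps the intervals nested whatever \<open>g\<close>
  and \<open>v\<close> are.\<close>

lemma branch_limit:
  assumes "\<And>q. lo q < hi q"
  shows "(SUP n. lo (branch lo hi g v n)) \<in> {lo (branch lo hi g v n)..hi (branch lo hi g v n)}"
proof -
  let ?q = "branch lo hi g v"
  have lo: "incseq (\<lambda>n. lo (?q n))"
    by (rule incseq_SucI) (simp add: Let_def)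
  have hi: "decseq (\<lambda>n. hi (?q n))"
    by (rule decseq_SucI) (simp add: Let_def)
  have le: "lo (?q m) \<le> hi (?q n)" for m n
  proof -
    have "lo (?q m) \<le> lo (?q (max m n))"
      using incseqD[OF lo, of m "max m n"] by simp
    also have "\<dots> \<le> hi (?q (max m n))"
      by (rule less_imp_le[OF assms])
    also have "\<dots> \<le> hi (?q n)"
      using decseqD[OF hi, of n "max m n"] by simp
    finally show ?thesis .
  qed
  then have "bdd_above (range (\<lambda>n. lo (?q n)))"
    by (intro bdd_aboveI[of _ "hi (?q 0)"]) (use le[of _ 0] in auto)
  then show ?thesis
    using le by (auto intro: cSUP_upper cSUP_least)
qed

lemma non_M_eq_aleph1_if:
  fixes x :: "omega1 \<Rightarrow> nat \<Rightarrow> nat"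
  assumes x: "\<And>M y. infinite M \<Longrightarrow> \<exists>\<beta>. infinite {n \<in> M. x \<beta> n = y n}"
  shows "non_M =o aleph1"
proof -
  obtain lo hi :: "nat \<Rightarrow> real" where less: "\<And>q. lo q < hi q"
    and base: "\<And>a b. a < b \<Longrightarrow> \<exists>q. a < lo q \<and> hi q < b"
    by (rule countable_interval_base) (rule that)
  \<comment> \<open>Both guesses come from the family \<open>x\<close>: the first coordinate
    supplies the growth rate, the second the reactions. So there are at most \<open>aleph1\<close>
    limits.\<close>
  define z where "z p = (SUP n. lo (branch lo hi (growth (x (fst p))) (x (snd p)) n))" for p
  have "\<not> meager (range z)"
  proof
    assume "meager (range z)"
    then obtain N :: "nat \<Rightarrow> real set"
      where N: "\<And>i. nowhere_dense (N i)" and range_z: "range z = (\<Union>i. N i)"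
      unfolding meager_def by blast
    \<comment> \<open>Every coded interval contains one avoiding the first \<open>n + 1\<close>
      nowhere dense sets; \<phi> picks it as the reaction at stage \<open>n\<close>.\<close>
    have "\<exists>q'. lo q \<le> lo q' \<and> hi q' \<le> hi q \<and> {lo q'..hi q'} \<inter> (\<Union>i\<le>n. N i) = {}" for n q
    proof -
      obtain c d where cd: "lo q < c" "c < d" "d < hi q" "{c..d} \<inter> (\<Union>i\<le>n. N i) = {}"
        using nowhere_dense_avoid[of N, OF N less] by blast
      obtain q' where q': "c < lo q'" "hi q' < d"
        using base[OF cd(2)] by blast
      then have "{lo q'..hi q'} \<subseteq> {c..d}"
        by auto
      then have "{lo q'..hi q'} \<inter> (\<Union>i\<le>n. N i) = {}"
        using cd(4) by blast
      then show ?thesis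
        using cd(1,3) q' by (intro exI[of _ q']) auto
    qed
    then have "\<forall>n q. \<exists>q'. lo q \<le> lo q' \<and> hi q' \<le> hi q \<and> {lo q'..hi q'} \<inter> (\<Union>i\<le>n. N i) = {}"
      by (intro allI)
    from this[unfolded choice_iff] obtain \<phi> where \<phi>_all: "\<forall>n q. lo q \<le> lo (\<phi> n q) \<and> hi (\<phi> n q) \<le> hi q \<and>
        {lo (\<phi> n q)..hi (\<phi> n q)} \<inter> (\<Union>i\<le>n. N i) = {}" ..
    have \<phi>: "lo q \<le> lo (\<phi> n q) \<and> hi (\<phi> n q) \<le> hi q \<and>
        {lo (\<phi> n q)..hi (\<phi> n q)} \<inter> (\<Union>i\<le>n. N i) = {}" for n q
      by (rule spec[OF spec[OF \<phi>_all]])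
    \<comment> \<open>\<open>F c\<close> bounds all reactions with arguments at most
      \<open>c\<close>. As \<open>n \<le> g n\<close>, the inequality
      \<open>F (g n) < g (Suc n)\<close> keeps the reactions at stage \<open>n\<close> to positions
      below \<open>g n\<close> under the limit \<open>g (Suc n)\<close>.\<close>
    define F where "F c = c + (\<Sum>n\<le>c. \<Sum>q\<le>c. \<phi> n q)" for c
    have "mono F"
      unfolding F_def by (intro monoI add_mono order_trans[OF sum_mono sum_mono2] sum_mono2) auto
    then obtain y where "\<forall>u. infinite {n. u n = y n} \<longrightarrow> infinite {n. F (growth u n) < growth u (Suc n)}"
      using growth_outpaces[of F] by (auto simp: F_def)
    moreover obtain \<beta> where "infinite {n. x \<beta> n = y n}"
      using x[of UNIV y] by auto
    ultimately have inf: "infinite {n. F (growth (x \<beta>) n) < growth (x \<beta>) (Suc n)}"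
      by blast
    define g where "g = growth (x \<beta>)"
    have g: "g n < g (Suc n)" "0 < g 0" "n \<le> g n" for n
    proof -
      show *: "g n < g (Suc n)" "0 < g 0" for n
        using less_growth[of "x \<beta>" 0] by (simp_all add: g_def growth_Suc)
      then have "strict_mono g"
        by (simp add: strict_mono_Suc_iff)
      then show "n \<le> g n"
        by (rule strict_mono_imp_increasing)
    qed
    \<comment> \<open>The target depends on \<open>g\<close>, so it is guessed second, and the
      agreements must fall among the stages where \<open>g\<close> grows fast. This is where
      agreement on any infinite set is used.\<close>
    obtain \<beta>' where \<beta>': "infinite {n \<in> {n. F (g n) < g (Suc n)}. x \<beta>' n = list_encode (map (\<phi> n) [0..<g n])}"
      using x[OF inf[folded g_def], of "\<lambda>n. list_encode (map (\<phi> n) [0..<g n])"] by blast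
    define Q where "Q = branch lo hi g (x \<beta>')"
    have notin: "z (\<beta>, \<beta>') \<notin> N i" for i
    proof -
      obtain n where n: "i \<le> n" "F (g n) < g (Suc n)" "x \<beta>' n = list_encode (map (\<phi> n) [0..<g n])"
        using \<beta>' unfolding infinite_nat_iff_unbounded_le by blast
      have Qn: "Q n < g n"
        unfolding Q_def using g by (intro branch_less)
      have "\<phi> n (Q n) \<le> (\<Sum>q\<le>g n. \<phi> n q)"
        using Qn by (intro member_le_sum) auto
      also have "\<dots> \<le> (\<Sum>m\<le>g n. \<Sum>q\<le>g n. \<phi> m q)"
        using g(3) by (intro member_le_sum[where f = "\<lambda>m. \<Sum>q\<le>g n. \<phi> m q"]) auto
      also have "\<dots> \<le> F (g n)"
        by (simp add: F_def)
      finally have "\<phi> n (Q n) < g (Suc n)"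
        using n(2) by simp
      \<comment> \<open>At a stage with a correct guess the reaction passes every test in
        \<open>branch\<close>.\<close>
      then have "Q (Suc n) = \<phi> n (Q n)"
        using \<phi>[of "Q n" n] Qn unfolding Q_def by (simp add: n(3) Let_def)
      moreover have "z (\<beta>, \<beta>') \<in> {lo (Q (Suc n))..hi (Q (Suc n))}"
        using branch_limit[of lo hi g "x \<beta>'" "Suc n"] less unfolding z_def Q_def g_def by simp
      ultimately show ?thesis
        using \<phi>[of "Q n" n] n(1) by auto
    qed
    have "z (\<beta>, \<beta>') \<in> (\<Union>i. N i)"
      unfolding range_z[symmetric] by (rule rangeI)
    then show False
      using notin by blast
  qed
  then have "non_M \<le>o |range z|"
    by (rule non_M_least(2))
  also have "|range z| \<le>o |(UNIV :: omega1 set) \<times> (UNIV :: omega1 set)|"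
    using card_of_image[of z UNIV] by simp
  also (ordLeq_transitive)
  have "|(UNIV :: omega1 set) \<times> (UNIV :: omega1 set)| =o |UNIV :: omega1 set|"
    using uncountable_UNIV_omega1 countable_finite by (intro card_of_Times_same_infinite) blast
  also (ordLeq_ordIso_trans) note card_of_omega1
  finally (ordLeq_ordIso_trans) have "non_M \<le>o aleph1" .
  moreover have "aleph1 \<le>o non_M"
  proof -
    obtain X :: "real set" where "\<not> meager X" "non_M = |X|"
      using non_M_least(1) by blast
    then show ?thesis
      using aleph1_le_card_of_uncountable[of X] countable_meager_real by auto
  qed
  ultimately show ?thesis
    by (simp add: ordIso_iff_ordLeq)
qed

section \<open>Infinitely often equal reals from a nonmeager set\<close>

lemma infinitely_often_equal_if_non_M_eq_aleph1:
  assumes "non_M =o aleph1"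
  shows "\<exists>X :: (nat \<Rightarrow> nat) set. |X| =o aleph1 \<and> (\<forall>y. \<exists>x\<in>X. infinite {n. x n = y n})"
proof -
  obtain X :: "real set" where X: "\<not> meager X" "non_M = |X|"
    using non_M_least(1) by blast
  \<comment> \<open>Every interval of length \<open>2 / n\<close> contains an interval on which \<open>h _ n\<close> is constant
    with a prescribed value.\<close>
  define h where "h r n = nat \<lfloor>1 / frac (real n * r)\<rfloor> - 1" for r n
  have "\<exists>r\<in>X. infinite {n. h r n = y n}" for y
  proof (rule ccontr)
    assume neg: "\<not> ?thesis"
    \<comment> \<open>If \<open>y\<close> escapes every \<open>h r\<close>, these sets cover
      \<open>X\<close>; each is nowhere dense because it misses the intervals on which
      \<open>h _ n\<close> is \<open>y n\<close> for some \<open>n \<ge> m\<close>.\<close>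
    define N where "N m = {r \<in> X. \<forall>n\<ge>m. h r n \<noteq> y n}" for m
    have "\<exists>m. r \<in> N m" if "r \<in> X" for r
    proof -
      have "finite {n. h r n = y n}"
        using neg that by blast
      then obtain m where "\<forall>n\<in>{n. h r n = y n}. n < m"
        unfolding finite_nat_set_iff_bounded by blast
      then show ?thesis
        using that by (intro exI[of _ m]) (auto simp: N_def not_less[symmetric])
    qed
    then have "X = (\<Union>m. N m)"
      by (auto simp: N_def)
    moreover have "nowhere_dense (N m)" for m
    proof (rule nowhere_dense_realI)
      fix a b :: real assume "a < b"
      obtain n0 :: nat where n0: "2 / (b - a) < real n0"
        using reals_Archimedean2 by blast
      define n where "n = Suc (max m n0)"
      have n: "m \<le> n" "0 < real n" "2 / (b - a) < real n"
        using n0 by (auto simp: n_def)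
      \<comment> \<open>A length above \<open>2 / n\<close> leaves room for the whole cell from
        \<open>k / n\<close> to \<open>(k + 1) / n\<close>, with \<open>k\<close> the least integer
        above \<open>a * n\<close>.\<close>
      define k where "k = \<lfloor>a * real n\<rfloor> + 1"
      \<comment> \<open>Between \<open>c\<close> and \<open>d\<close>,
        \<open>frac (real n * r)\<close> lies strictly between \<open>1 / (v + 1)\<close> and
        \<open>1 / v\<close>, so its reciprocal has floor \<open>v\<close>. The shift by one keeps
        \<open>v\<close> positive when \<open>y n = 0\<close> and matches the \<open>- 1\<close> in
        \<open>h\<close>.\<close>
      define v where "v = real (y n) + 1"
      define c d where "c = (of_int k + 1 / (v + 1)) / real n" and "d = (of_int k + 1 / v) / real n"
      have v: "v \<ge> 1"
        by (simp add: v_def)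
      have k: "a * real n < of_int k" "of_int k \<le> a * real n + 1"
        unfolding k_def by linarith+
      have v1: "1 / (v + 1) < 1 / v" "0 < 1 / (v + 1)" "1 / v \<le> 1"
        using v by (auto simp: field_simps)
      have "a \<le> c"
      proof -
        have "a * real n \<le> of_int k + 1 / (v + 1)"
          using k v1 by linarith
        then show ?thesis
          using n(2) by (simp add: c_def pos_le_divide_eq)
      qed
      moreover have "c < d"
        using v1 n(2) by (simp add: c_def d_def divide_strict_right_mono)
      moreover have "d \<le> b"
      proof -
        have "of_int k + 1 / v \<le> a * real n + 2"
          using k(2) v1(3) by simp
        also have "2 \<le> (b - a) * real n"
          using n(3) \<open>a < b\<close> by (simp add: field_simps)
        finally show ?thesis
          using n(2) by (simp add: d_def pos_divide_le_eq algebra_simps)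
      qed
      moreover have "h r n = y n" if "r \<in> {c<..<d}" for r
      proof -
        have r: "1 / (v + 1) < real n * r - of_int k" "real n * r - of_int k < 1 / v"
          using that n(2) by (auto simp: c_def d_def field_simps)
        then have "0 \<le> real n * r - of_int k" "real n * r - of_int k < 1"
          using v1 by linarith+
        then have fr: "frac (real n * r) = real n * r - of_int k"
          by (simp add: frac_unique_iff)
        have "v < 1 / frac (real n * r)" "1 / frac (real n * r) < v + 1"
          using r v v1 unfolding fr by (auto simp: field_simps)
        then have "\<lfloor>1 / frac (real n * r)\<rfloor> = int (y n + 1)"
          by (intro floor_unique) (auto simp: v_def)
        then show ?thesis
          by (simp add: h_def nat_add_distrib)
      qed
      ultimately show "\<exists>c d. a \<le> c \<and> c < d \<and> d \<le> b \<and> {c<..<d} \<inter> N m = {}"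
        using n(1) by (intro exI[of _ c] exI[of _ d]) (auto simp: N_def)
    qed
    ultimately show False
      using X(1) unfolding meager_def by blast
  qed
  then have "\<forall>y. \<exists>x\<in>h ` X. infinite {n. x n = y n}"
    by blast
  moreover have "|h ` X| \<le>o aleph1"
    using card_of_image[of h X] assms X(2) ordLeq_ordIso_trans by metis
  ultimately show ?thesis
    by (intro infinitely_often_equal_card_aleph1)
qed

section \<open>The cycle of implications\<close>

theorem theorem3p1:
  shows "all_equivalent
   [non_M =o aleph1,

    \<exists>f :: nat \<Rightarrow> omega1 \<Rightarrow> omega1.
      \<forall>B. \<not> bdd_above B \<longrightarrow> (\<exists>m. f m ` B = UNIV),

    \<exists>g :: nat \<Rightarrow> omega1 \<Rightarrow> omega1.
      \<forall>\<B>. uncountable \<B> \<and> disjoint \<B> \<and> (\<forall>b\<in>\<B>. finite b) \<longrightarrow>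
        infinite {n. \<forall>\<gamma>. \<exists>b\<in>\<B>. g n ` b = {\<gamma>}},

    \<exists>c :: omega1 \<Rightarrow> omega1 \<Rightarrow> omega1 \<times> nat.
      finite_to_one_fibers c \<and>
      (\<forall>k \<A> l \<B>.
        \<A> \<subseteq> k_subsets k \<and> infinite \<A> \<and> disjoint \<A> \<and>
        \<B> \<subseteq> k_subsets l \<and> uncountable \<B> \<and> disjoint \<B> \<longrightarrow>
        (\<exists>a\<in>\<A>. \<forall>\<delta>. \<exists>\<iota>. \<exists>b\<in>\<B>. \<forall>\<beta>\<in>b. {\<alpha>. \<alpha> < \<beta> \<and> c \<alpha> \<beta> = (\<delta>, \<iota>)} = a)),

    \<forall>p. linf_coherent p \<longrightarrow>
      (\<exists>d :: omega1 \<Rightarrow> omega1 \<Rightarrow> omega1.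
        \<forall>k \<A> l \<B>.
          \<A> \<subseteq> k_subsets k \<and> infinite \<A> \<and> disjoint \<A> \<and>
          \<B> \<subseteq> k_subsets l \<and> uncountable \<B> \<and> disjoint \<B> \<longrightarrow>
          (\<exists>a\<in>\<A>. \<forall>\<tau> :: nat \<Rightarrow> nat \<Rightarrow> nat \<Rightarrow> omega1. \<exists>b\<in>\<B>. \<forall>n<k. \<forall>m<l.
            nth_elem a n < nth_elem b m \<and>
            d (nth_elem a n) (nth_elem b m) = \<tau> n m (p (nth_elem a n) (nth_elem b m)))),

    \<exists>e :: omega1 \<Rightarrow> omega1 \<Rightarrow> nat.
      \<forall>A B. infinite A \<and> uncountable B \<longrightarrow>
        (\<exists>\<alpha>\<in>A. {e \<alpha> \<beta> | \<beta>. \<beta> \<in> B \<and> \<alpha> < \<beta>} = UNIV),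

    \<exists>X :: (nat \<Rightarrow> nat) set. |X| =o aleph1 \<and>
      (\<forall>y. \<exists>x\<in>X. infinite {n. x n = y n})]"
proof -
  define P1 where "P1 \<longleftrightarrow>
     (non_M =o aleph1)"
  define P2 where "P2 \<longleftrightarrow>
     (\<exists>f :: nat \<Rightarrow> omega1 \<Rightarrow> omega1.
      \<forall>B. \<not> bdd_above B \<longrightarrow> (\<exists>m. f m ` B = UNIV))"
  define P3 where "P3 \<longleftrightarrow>
     (\<exists>g :: nat \<Rightarrow> omega1 \<Rightarrow> omega1.
      \<forall>\<B>. uncountable \<B> \<and> disjoint \<B> \<and> (\<forall>b\<in>\<B>. finite b) \<longrightarrow>
        infinite {n. \<forall>\<gamma>. \<exists>b\<in>\<B>. g n ` b = {\<gamma>}})"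
  define P4 where "P4 \<longleftrightarrow>
     (\<exists>c :: omega1 \<Rightarrow> omega1 \<Rightarrow> omega1 \<times> nat.
      finite_to_one_fibers c \<and>
      (\<forall>k \<A> l \<B>.
        \<A> \<subseteq> k_subsets k \<and> infinite \<A> \<and> disjoint \<A> \<and>
        \<B> \<subseteq> k_subsets l \<and> uncountable \<B> \<and> disjoint \<B> \<longrightarrow>
        (\<exists>a\<in>\<A>. \<forall>\<delta>. \<exists>\<iota>. \<exists>b\<in>\<B>. \<forall>\<beta>\<in>b. {\<alpha>. \<alpha> < \<beta> \<and> c \<alpha> \<beta> = (\<delta>, \<iota>)} = a)))"
  define P5 where "P5 \<longleftrightarrow>
     (\<forall>p. linf_coherent p \<longrightarrow>
      (\<exists>d :: omega1 \<Rightarrow> omega1 \<Rightarrow> omega1.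
        \<forall>k \<A> l \<B>.
          \<A> \<subseteq> k_subsets k \<and> infinite \<A> \<and> disjoint \<A> \<and>
          \<B> \<subseteq> k_subsets l \<and> uncountable \<B> \<and> disjoint \<B> \<longrightarrow>
          (\<exists>a\<in>\<A>. \<forall>\<tau> :: nat \<Rightarrow> nat \<Rightarrow> nat \<Rightarrow> omega1. \<exists>b\<in>\<B>. \<forall>n<k. \<forall>m<l.
            nth_elem a n < nth_elem b m \<and>
            d (nth_elem a n) (nth_elem b m) = \<tau> n m (p (nth_elem a n) (nth_elem b m)))))"
  define P6 where "P6 \<longleftrightarrow>
     (\<exists>e :: omega1 \<Rightarrow> omega1 \<Rightarrow> nat.
      \<forall>A B. infinite A \<and> uncountable B \<longrightarrow>
        (\<exists>\<alpha>\<in>A. {e \<alpha> \<beta> | \<beta>. \<beta> \<in> B \<and> \<alpha> < \<beta>} = UNIV))"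
  define P7 where "P7 \<longleftrightarrow>
     (\<exists>X :: (nat \<Rightarrow> nat) set. |X| =o aleph1 \<and>
      (\<forall>y. \<exists>x\<in>X. infinite {n. x n = y n}))"
  \<comment> \<open>\<open>P7\<close> is the hub: it follows from \<open>P1\<close> and from
    \<open>P2\<close>, yields \<open>P3\<close> and hence \<open>P2\<close>, and leads through
    \<open>P4\<close> or \<open>P5\<close> to \<open>P6\<close> and back to
    \<open>P1\<close>.\<close>
  have 17: P7 if hyp: P1
    using hyp unfolding P1_def P7_def by (rule infinitely_often_equal_if_non_M_eq_aleph1)
  have guess: "\<exists>g. guessing g" if hyp: P7
    using hyp unfolding P7_def by (elim exE conjE) (rule guessing_if_infinitely_often_equal)
  have 73: P3 if hyp: P7
  proof -
    obtain g where "guessing g"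
      using guess[OF hyp] ..
    then show P3
      unfolding P3_def
      by (intro exI[of _ g] allI impI, elim conjE) (rule constant_images_if_guessing)
  qed
  have 32: P2 if hyp: P3
  proof -
    obtain g :: "nat \<Rightarrow> omega1 \<Rightarrow> omega1"
      where g: "\<forall>\<B>. uncountable \<B> \<and> disjoint \<B> \<and> (\<forall>b\<in>\<B>. finite b) \<longrightarrow>
        infinite {n. \<forall>\<gamma>. \<exists>b\<in>\<B>. g n ` b = {\<gamma>}}"
      using hyp unfolding P3_def ..
    show P2
      unfolding P2_def
      by (intro exI[of _ g] allI impI)
        (rule cofinal_image_if_constant_images[OF mp[OF spec[OF g]]])
  qed
  have 27: P7 if hyp: P2
  proof -
    obtain f :: "nat \<Rightarrow> omega1 \<Rightarrow> omega1"
      where f: "\<forall>B. \<not> bdd_above B \<longrightarrow> (\<exists>m. f m ` B = UNIV)"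
      using hyp unfolding P2_def ..
    show P7
      unfolding P7_def by (rule infinitely_often_equal_if_cofinal_image[OF mp[OF spec[OF f]]])
  qed
  have 74: P4 if hyp: P7
  proof -
    obtain g where "guessing g"
      using guess[OF hyp] ..
    then show P4
      unfolding P4_def by (rule fiber_coloring_if_guessing)
  qed
  have 75: P5 if hyp: P7
  proof -
    obtain g where "guessing g"
      using guess[OF hyp] ..
    then show P5
      unfolding P5_def by (intro allI impI) (rule matrix_coloring_if_guessing)
  qed
  have 46: P6 if hyp: P4
    using hyp unfolding P4_def
  proof (elim exE conjE)
    fix c :: "omega1 \<Rightarrow> omega1 \<Rightarrow> omega1 \<times> nat"
    assume c: "\<forall>k \<A> l \<B>.
        \<A> \<subseteq> k_subsets k \<and> infinite \<A> \<and> disjoint \<A> \<and>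
        \<B> \<subseteq> k_subsets l \<and> uncountable \<B> \<and> disjoint \<B> \<longrightarrow>
        (\<exists>a\<in>\<A>. \<forall>\<delta>. \<exists>\<iota>. \<exists>b\<in>\<B>. \<forall>\<beta>\<in>b. {\<alpha>. \<alpha> < \<beta> \<and> c \<alpha> \<beta> = (\<delta>, \<iota>)} = a)"
    show P6
      unfolding P6_def
      by (rule all_colors_if_fiber_coloring[OF mp[OF spec[OF spec[OF spec[OF spec[OF c]]]]]])
  qed
  have 56: P6 if hyp: P5
  proof -
    \<comment> \<open>The zero partition is coherent, and \<open>P5\<close> for it already gives a
      coloring for \<open>P6\<close>.\<close>
    have "linf_coherent (\<lambda>_ _. 0)"
      by (simp add: linf_coherent_def)
    with hyp[unfolded P5_def, THEN spec, of "\<lambda>_ _. 0"]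
    obtain d :: "omega1 \<Rightarrow> omega1 \<Rightarrow> omega1" where d: "\<forall>k \<A> l \<B>.
          \<A> \<subseteq> k_subsets k \<and> infinite \<A> \<and> disjoint \<A> \<and>
          \<B> \<subseteq> k_subsets l \<and> uncountable \<B> \<and> disjoint \<B> \<longrightarrow>
          (\<exists>a\<in>\<A>. \<forall>\<tau> :: nat \<Rightarrow> nat \<Rightarrow> nat \<Rightarrow> omega1. \<exists>b\<in>\<B>. \<forall>n<k. \<forall>m<l.
            nth_elem a n < nth_elem b m \<and>
            d (nth_elem a n) (nth_elem b m) = \<tau> n m 0)"
      by (elim impE exE)
    show P6
      unfolding P6_def
      by (rule all_colors_if_matrix_coloring[where p = "\<lambda>_ _. 0",
            OF mp[OF spec[OF spec[OF spec[OF spec[OF d]]]]]])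
  qed
  have 61: P1 if hyp: P6
  proof -
    obtain e :: "omega1 \<Rightarrow> omega1 \<Rightarrow> nat" where e: "\<forall>A B. infinite A \<and> uncountable B \<longrightarrow>
        (\<exists>\<alpha>\<in>A. {e \<alpha> \<beta> | \<beta>. \<beta> \<in> B \<and> \<alpha> < \<beta>} = UNIV)"
      using hyp unfolding P6_def ..
    obtain x :: "omega1 \<Rightarrow> nat \<Rightarrow> nat"
      where x: "\<forall>M y. infinite M \<longrightarrow> (\<exists>\<beta>. infinite {n \<in> M. x \<beta> n = y n})"
      using infinitely_often_equal_on_infinite_if_all_colors[OF mp[OF spec[OF spec[OF e]]]] ..
    show P1
      unfolding P1_def by (rule non_M_eq_aleph1_if[OF mp[OF spec[OF spec[OF x]]]])
  qed
  have "P1 \<longleftrightarrow> P7" "P2 \<longleftrightarrow> P7" "P3 \<longleftrightarrow> P7" "P4 \<longleftrightarrow> P7" "P5 \<longleftrightarrow> P7" "P6 \<longleftrightarrow> P7"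
    using 17 73 32 27 74 75 46 56 61 by satx+
  then have "all_equivalent [P1, P2, P3, P4, P5, P6, P7]"
    unfolding all_equivalent_def by simp
  then show ?thesis
    unfolding P1_def P2_def P3_def P4_def P5_def P6_def P7_def .
qed

end
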